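(* There is an absolute constant $K>0$ such that for every odd prime $p$ and every integer $a$ with $p\nmid a$, $$\left|\sum_{b=1}^{p-1}\sum_{c=1}^{p-1}\left(\frac{b^2-a^2c^2}{p}\right)\left(\frac{b^2-1}{p}\right)\left(\frac{c^2-1}{p}\right)\right|\le K\,p.$$
   Context: $\left(\frac{\cdot}{p}\right)$ denotes the Legendre symbol modulo $p$ (with $\left(\frac{0}{p}\right)=0$). *)

theory Defs
  imports "HOL-Number_Theory.Number_Theory"
begin

end

theory Submission
  imports Defs "HOL-Computational_Algebra.Polynomial" "HOL-Library.Discrete_Functions"
begin

text \<open>
  Put \<open>l = a^2\<close> and write \<open>chi\<close> for the Legendre symbol. Substituting \<open>u = b^2\<close>, \<open>v = c^2\<close> turns
  the sum into \<open>\<Sum> (1 + chi u) (1 + chi v) chi (u - l v) chi (u - 1) chi (v - 1)\<close> up to \<open>2 p\<close>.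
  Every term except \<open>T = \<Sum> chi (u v (u - 1) (v - 1) (u - l v))\<close> contains an inner sum of \<open>chi\<close>
  over a product of two linear factors, so it is \<open>O(p)\<close>.

  A finite-field version of Clausen's identity, valid up to \<open>O(p)\<close>, gives \<open>T = \<plusminus>A^2\<close> with
  \<open>A = \<Sum> chi (x q(x))\<close>, \<open>q(x) = x^2 + 2 \<beta> x + \<gamma>\<close> and \<open>\<beta>^2 = \<gamma> (1 - l)\<close>. To see this, put \<open>x = s y\<close> in
  \<open>A^2 = \<Sum> chi (x q(x)) chi (y q(y))\<close> and collect the \<open>y\<close> with \<open>q(s y) = v q(y)\<close>; their number is
  governed by a discriminant which, for \<open>v = s w\<close>, depends only on \<open>s + 1/s\<close> and \<open>w + 1/w\<close>, and
  is linear in these.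

  Finally \<open>A = O(\<surd>p)\<close> by Stepanov's method. The polynomials live over the integers and are
  considered modulo \<open>p\<close>, since no type depends on \<open>p\<close>.
\<close>

section \<open>Multiple roots of integer polynomials modulo a prime\<close>


text \<open>Taylor's formula at \<open>r\<close>, multiplied by \<open>k!\<close> so that it stays
  over the integers.\<close>

lemma coeff_pcompose_shift_fact:
  fixes P :: "int poly"
  shows "fact k * coeff (P \<circ>\<^sub>p [:r, 1:]) k = poly ((pderiv ^^ k) P) r"
proof -
  have shift: "(pderiv ^^ k) (P \<circ>\<^sub>p [:r, 1:]) = (pderiv ^^ k) P \<circ>\<^sub>p [:r, 1:]"
    by (induction k) (simp_all add: pderiv_pcompose pderiv_pCons)
  have "fact k * coeff (P \<circ>\<^sub>p [:r, 1:]) k = coeff ((pderiv ^^ k) (P \<circ>\<^sub>p [:r, 1:])) 0"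
    by (simp add: coeff_higher_pderiv pochhammer_fact)
  also have "\<dots> = poly ((pderiv ^^ k) P) r"
    unfolding shift by (simp add: poly_0_coeff_0 [symmetric] poly_pcompose)
  finally show ?thesis .
qed

text \<open>For \<open>k < l <= p\<close> the factor \<open>k!\<close> is invertible modulo
  \<open>p\<close>, so the Taylor coefficients of \<open>P\<close> at \<open>r\<close> of order
  below \<open>l\<close> vanish modulo \<open>p\<close>.\<close>

lemma root_power_dvd_mod:
  fixes P :: "int poly" and p :: nat
  assumes p: "prime p" and l: "l \<le> p"
    and van: "\<And>k. k < l \<Longrightarrow> int p dvd poly ((pderiv ^^ k) P) r"
  shows "\<exists>Q. [:int p:] dvd P - Q * [:- r, 1:] ^ l"
proof -
  define S where "S = P \<circ>\<^sub>p [:r, 1:]"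
  have "int p dvd coeff S k" if "k < l" for k
  proof -
    have "int p dvd fact k * coeff S k"
      using van [OF that] by (simp add: S_def coeff_pcompose_shift_fact)
    moreover have "\<not> int p dvd fact k"
    proof
      assume "int p dvd fact k"
      then have "p dvd fact k" by (metis int_dvd_int_iff of_nat_fact)
      then show False using prime_dvd_fact_iff [OF p, of k] l that by simp
    qed
    ultimately show ?thesis
      using p by (simp add: prime_dvd_mult_iff)
  qed
  then have "[:int p:] dvd poly_cutoff l S"
    by (simp add: const_poly_dvd_iff coeff_poly_cutoff)
  then obtain E where E: "poly_cutoff l S = [:int p:] * E" by blast
  \<comment> \<open>The Taylor expansion splits at order \<open>l\<close>; the lower part is the
    multiple of \<open>p\<close> just found.\<close>
  have "S = poly_shift l S * [:0, 1:] ^ l + [:int p:] * E"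
    unfolding E [symmetric]
    by (auto simp: poly_eq_iff coeff_poly_shift coeff_poly_cutoff mult.commute [of "poly_shift _ _"]
        monom_altdef [of 1, simplified, symmetric] coeff_monom_mult)
  then have "S \<circ>\<^sub>p [:- r, 1:] = (poly_shift l S * [:0, 1:] ^ l + [:int p:] * E) \<circ>\<^sub>p [:- r, 1:]"
    by simp
  moreover have "S \<circ>\<^sub>p [:- r, 1:] = P"
    by (simp add: S_def pcompose_assoc [symmetric] pcompose_pCons)
  moreover have "[:0, 1:] ^ l \<circ>\<^sub>p [:- r, 1:] = [:- r, 1:] ^ l"
    by (induction l) (simp_all add: pcompose_mult pcompose_pCons pcompose_1)
  ultimately have "P - (poly_shift l S \<circ>\<^sub>p [:- r, 1:]) * [:- r, 1:] ^ l = [:int p:] * (E \<circ>\<^sub>p [:- r, 1:])"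
    by (simp add: pcompose_add pcompose_mult pcompose_smult)
  then show ?thesis by (metis dvd_triv_left)
qed

lemma root_dvd_mod:
  fixes Q :: "int poly"
  assumes "int p dvd poly Q r"
  shows "\<exists>Q'. [:int p:] dvd Q - Q' * [:- r, 1:]"
proof -
  have "Q - synthetic_div Q r * [:- r, 1:] = [:poly Q r:]"
    using synthetic_div_correct' [of r Q] by (simp add: algebra_simps)
  moreover have "[:int p:] dvd [:poly Q r:]"
    using assms by (simp add: const_poly_dvd_iff coeff_pCons split: nat.split)
  ultimately show ?thesis by metis
qed

lemma not_const_dvd_monic:
  fixes M :: "int poly"
  assumes p: "prime p" and M: "lead_coeff M = 1"
  shows "\<not> [:int p:] dvd M"
proof
  assume "[:int p:] dvd M"
  then have "int p dvd 1" using M by (metis const_poly_dvd_iff)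
  then show False using p by auto
qed

lemma prime_elem_const_int:
  "prime p \<Longrightarrow> prime_elem [:int p:]"
  by (intro lift_prime_elem_poly) simp

text \<open>Modulo \<open>p\<close> the factor \<open>M\<close> is coprime to \<open>x - r\<close>.
  Powers of \<open>x - r\<close> are split off \<open>Q\<close> one at a time: cancel the monic
  \<open>(x - r)^k\<close>, then evaluate at \<open>r\<close>.\<close>

lemma root_power_dvd_mod_cancel:
  fixes Q M :: "int poly"
  assumes p: "prime p" and M: "\<not> int p dvd poly M r"
    and QM: "[:int p:] dvd Q * M - A * [:- r, 1:] ^ l"
  shows "\<exists>Q'. [:int p:] dvd Q - Q' * [:- r, 1:] ^ l"
proof -
  have "\<exists>Q'. [:int p:] dvd Q - Q' * [:- r, 1:] ^ k" if "k \<le> l" for k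
    using that
  proof (induction k)
    case 0
    then show ?case by (intro exI [of _ Q]) simp
  next
    case (Suc k)
    let ?X = "[:- r, 1:]"
    obtain Q' where Q': "[:int p:] dvd Q - Q' * ?X ^ k" using Suc by auto
    have X: "?X ^ l = ?X ^ k * ?X ^ (l - k)" using Suc.prems by (simp add: power_add [symmetric])
    have "[:int p:] dvd (Q * M - A * ?X ^ l) - (Q - Q' * ?X ^ k) * M"
      by (intro dvd_diff [OF QM] dvd_mult2 [OF Q'])
    also have "\<dots> = ?X ^ k * (Q' * M - A * ?X ^ (l - k))"
      by (simp only: X) (simp add: algebra_simps)
    finally have "[:int p:] dvd Q' * M - A * ?X ^ (l - k)"
      using prime_elem_dvd_mult_iff [OF prime_elem_const_int [OF p]]
        not_const_dvd_monic [OF p, of "?X ^ k"] by (auto simp: lead_coeff_power)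
    then obtain E where "Q' * M - A * ?X ^ (l - k) = [:int p:] * E" by blast
    then have "poly (Q' * M - A * ?X ^ (l - k)) r = poly ([:int p:] * E) r" by simp
    then have "poly Q' r * poly M r = int p * poly E r" using Suc.prems by (simp add: power_0_left)
    then have "int p dvd poly Q' r * poly M r" by simp
    then have "int p dvd poly Q' r" using M p by (simp add: prime_dvd_mult_iff)
    then obtain Q'' where "[:int p:] dvd Q' - Q'' * ?X" using root_dvd_mod by blast
    then have "[:int p:] dvd (Q - Q' * ?X ^ k) + (Q' - Q'' * ?X) * ?X ^ k"
      using Q' by (intro dvd_add) auto
    then have "[:int p:] dvd Q - Q'' * ?X ^ Suc k" by (simp add: algebra_simps)
    then show ?case by blast
  qed
  then show ?thesis by blast
qed

lemma prod_root_powers_dvd_mod: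
  fixes P :: "int poly"
  assumes p: "prime p" and R: "finite R" "R \<subseteq> {0..<int p}"
    and l: "\<And>r. r \<in> R \<Longrightarrow> \<exists>Q. [:int p:] dvd P - Q * [:- r, 1:] ^ l"
  shows "\<exists>Q. [:int p:] dvd P - Q * (\<Prod>r\<in>R. [:- r, 1:] ^ l)"
  using R l
proof (induction R rule: finite_induct)
  case empty
  then show ?case by (intro exI [of _ P]) simp
next
  case (insert r R)
  let ?M = "\<Prod>r\<in>R. [:- r, 1:] ^ l"
  obtain Q where Q: "[:int p:] dvd P - Q * ?M" using insert by auto
  obtain A where A: "[:int p:] dvd P - A * [:- r, 1:] ^ l" using insert.prems by blast
  have "[:int p:] dvd (P - A * [:- r, 1:] ^ l) - (P - Q * ?M)" using A Q by (rule dvd_diff)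
  then have QM: "[:int p:] dvd Q * ?M - A * [:- r, 1:] ^ l" by simp
  have "\<not> int p dvd poly ?M r"
  proof
    assume "int p dvd poly ?M r"
    then have "\<exists>s\<in>R. int p dvd (r - s) ^ l"
      using p insert.hyps by (simp add: poly_prod poly_power prime_dvd_prod_iff)
    then obtain s where s: "s \<in> R" "int p dvd r - s" using p prime_dvd_power by (metis prime_nat_int_transfer)
    then have "r mod int p = s mod int p" by (simp add: mod_eq_dvd_iff)
    moreover have "r \<in> {0..<int p}" "s \<in> {0..<int p}" using s insert.prems by auto
    ultimately show False using s insert.hyps by auto
  qed
  then obtain Q' where Q': "[:int p:] dvd Q - Q' * [:- r, 1:] ^ l"
    using root_power_dvd_mod_cancel [OF p _ QM] by blast
  have "[:int p:] dvd (P - Q * ?M) + (Q - Q' * [:- r, 1:] ^ l) * ?M"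
    using Q Q' by (intro dvd_add) auto
  also have "\<dots> = P - Q' * (\<Prod>r\<in>insert r R. [:- r, 1:] ^ l)"
    using insert.hyps by (simp add: algebra_simps)
  finally show ?case by blast
qed

text \<open>Once the coefficients of \<open>Q\<close> are reduced into \<open>[0, p)\<close>, its
  leading one is not divisible by \<open>p\<close>, so the top coefficient of \<open>Q' * M\<close>
  must be matched by one of \<open>P\<close>.\<close>

lemma degree_ge_monic_dvd_mod:
  fixes P Q M :: "int poly"
  assumes p: "prime p" and M: "lead_coeff M = 1" and P: "\<not> [:int p:] dvd P"
    and QM: "[:int p:] dvd P - Q * M"
  shows "degree M \<le> degree P"
proof -
  define Q' where "Q' = map_poly (\<lambda>x. x mod int p) Q"
  have c: "coeff Q' i = coeff Q i mod int p" for i by (simp add: Q'_def coeff_map_poly)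
  have "[:int p:] dvd Q - Q'" by (simp add: const_poly_dvd_iff c)
  then have "[:int p:] dvd (P - Q * M) + (Q - Q') * M" using QM by (intro dvd_add) auto
  then have d: "[:int p:] dvd P - Q' * M" by (simp add: algebra_simps)
  have "Q' \<noteq> 0" using d P by auto
  then have "lead_coeff Q' mod int p \<noteq> 0" using c by (metis leading_coeff_0_iff mod_mod_trivial)
  moreover have "int p dvd coeff (P - Q' * M) (degree Q' + degree M)"
    using d by (simp add: const_poly_dvd_iff)
  then have "int p dvd coeff P (degree Q' + degree M) - lead_coeff Q'"
    using M by (simp add: coeff_mult_degree_sum)
  ultimately have "coeff P (degree Q' + degree M) \<noteq> 0" by (metis diff_0 dvd_imp_mod_0 dvd_minus_iff)
  then show ?thesis using le_degree by fastforce
qed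

text \<open>Vanishing derivatives below order \<open>l\<close> mean roots of multiplicity at least
  \<open>l\<close>; the product of the \<open>(x - r)^l\<close> is monic and divides
  \<open>P\<close> modulo \<open>p\<close>.\<close>

lemma card_multiple_roots_mod_le:
  fixes P :: "int poly"
  assumes p: "prime p" and l: "l \<le> p" and P: "\<not> [:int p:] dvd P"
    and R: "R \<subseteq> {0..<int p}"
    and van: "\<And>r k. r \<in> R \<Longrightarrow> k < l \<Longrightarrow> int p dvd poly ((pderiv ^^ k) P) r"
  shows "l * card R \<le> degree P"
proof -
  let ?M = "\<Prod>r\<in>R. [:- r, 1:] ^ l"
  have fin: "finite R" using R finite_subset by blast
  obtain Q where "[:int p:] dvd P - Q * ?M"
    using prod_root_powers_dvd_mod [OF p fin R] root_power_dvd_mod [OF p l van] by blast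
  then have "degree ?M \<le> degree P"
    using degree_ge_monic_dvd_mod [OF p _ P] by (simp add: lead_coeff_prod lead_coeff_power)
  moreover have "degree ?M = l * card R"
    by (subst degree_prod_sum_eq) (auto simp: degree_power_eq)
  ultimately show ?thesis by simp
qed

text \<open>Pigeonhole instead of linear algebra: two assignments with entries in
  \<open>[0, p)\<close> have the same residues of \<open>L\<close> on \<open>K\<close>, and their
  difference is a nontrivial solution.\<close>

lemma homogeneous_system_mod:
  fixes L :: "('i \<Rightarrow> int) \<Rightarrow> 'k \<Rightarrow> int"
  assumes p: "p > 1" and fin: "finite I" "finite K" and less: "card K < card I"
    and L: "\<And>c c' k. L (\<lambda>i. c i - c' i) k = L c k - L c' k"
  shows "\<exists>c. (\<exists>i\<in>I. \<not> int p dvd c i) \<and> (\<forall>k\<in>K. int p dvd L c k)"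
proof -
  let ?F = "{0..<int p}"
  define \<Phi> where "\<Phi> c = restrict (\<lambda>k. L c k mod int p) K" for c
    have "card (PiE K (\<lambda>_. ?F)) < card (PiE I (\<lambda>_. ?F))"
      using p less fin by (simp add: card_PiE)
    moreover have "\<Phi> ` PiE I (\<lambda>_. ?F) \<subseteq> PiE K (\<lambda>_. ?F)"
      using p by (auto simp: \<Phi>_def)
    ultimately have "\<not> inj_on \<Phi> (PiE I (\<lambda>_. ?F))"
      using card_inj_on_le fin by (metis finite_PiE finite_atLeastLessThan_int not_le)
    then obtain c c' where c: "c \<in> PiE I (\<lambda>_. ?F)" "c' \<in> PiE I (\<lambda>_. ?F)" "c \<noteq> c'" "\<Phi> c = \<Phi> c'"
      unfolding inj_on_def by blast
    obtain i where i: "i \<in> I" "c i \<noteq> c' i" using c PiE_ext by blast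
    have "c i mod int p \<noteq> c' i mod int p" using c(1,2) i by (auto simp: PiE_iff)
    then have "\<not> int p dvd c i - c' i" by (simp add: mod_eq_dvd_iff)
    moreover have "int p dvd L (\<lambda>i. c i - c' i) k" if "k \<in> K" for k
      using c(4) that unfolding L \<Phi>_def by (metis restrict_apply' mod_eq_dvd_iff)
    ultimately show ?thesis using i by (intro exI [of _ "\<lambda>i. c i - c' i"]) auto
qed

section \<open>Stepanov's method\<close>

text \<open>The cofactor left when \<open>f ^ (N - k)\<close> is taken out of the
  \<open>k\<close>-th derivative of \<open>f ^ N * h\<close>. The factor \<open>N - k\<close> is an
  integer, so no truncation interferes with the recursion.\<close>

primrec power_deriv :: "int poly \<Rightarrow> nat \<Rightarrow> nat \<Rightarrow> int poly \<Rightarrow> int poly" where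
  "power_deriv f N 0 h = h"
| "power_deriv f N (Suc k) h =
    smult (int N - int k) (pderiv f * power_deriv f N k h) + f * pderiv (power_deriv f N k h)"

lemma higher_pderiv_power_mult:
  "k \<le> N \<Longrightarrow> (pderiv ^^ k) (f ^ N * h) = f ^ (N - k) * power_deriv f N k h"
proof (induction k)
  case (Suc k)
  then obtain m where m: "N - k = Suc m" "N - Suc k = m" "int N - int k = int (Suc m)"
    by (metis Suc_diff_Suc Suc_leD Suc_le_lessD of_nat_diff)
  have "(pderiv ^^ Suc k) (f ^ N * h) = pderiv (f ^ Suc m * power_deriv f N k h)"
    using Suc m by simp
  also have "\<dots> = f ^ m * power_deriv f N (Suc k) h"
    unfolding pderiv_mult pderiv_power_Suc power_deriv.simps m(3)
    by (simp add: algebra_simps smult_add_left)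
  finally show ?case using m by simp
qed simp

lemma power_deriv_smult: "power_deriv f N k (smult c h) = smult c (power_deriv f N k h)"
  by (induction k) (simp_all add: pderiv_smult smult_add_right mult.commute)

lemma power_deriv_add: "power_deriv f N k (g + h) = power_deriv f N k g + power_deriv f N k h"
  by (induction k) (simp_all add: pderiv_add algebra_simps smult_add_right)

lemma power_deriv_0: "power_deriv f N k 0 = 0"
  by (induction k) simp_all

lemma power_deriv_sum: "power_deriv f N k (\<Sum>i\<in>A. g i) = (\<Sum>i\<in>A. power_deriv f N k (g i))"
  by (induction A rule: infinite_finite_induct) (simp_all add: power_deriv_0 power_deriv_add)

text \<open>A polynomial whose derivative is zero modulo \<open>p\<close>, such as
  \<open>x^(p j)\<close>, behaves like a constant under differentiation.\<close>

lemma power_deriv_mult_const_mod: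
  assumes M: "[:int p:] dvd pderiv M"
  shows "[:int p:] dvd power_deriv f N k (h * M) - power_deriv f N k h * M"
proof (induction k)
  case (Suc k)
  let ?G = "power_deriv f N k (h * M)" and ?g = "power_deriv f N k h"
  obtain E where E: "?G - ?g * M = [:int p:] * E" using Suc by blast
  obtain E' where E': "pderiv M = [:int p:] * E'" using M by blast
  have G: "?G = ?g * M + [:int p:] * E" using E by (simp add: algebra_simps)
  have "pderiv ?G = pderiv ?g * M + [:int p:] * (?g * E' + pderiv E)"
    unfolding G by (simp add: pderiv_add pderiv_mult pderiv_smult E' algebra_simps smult_add_right)
  then have "power_deriv f N (Suc k) (h * M) - power_deriv f N (Suc k) h * M =
      [:int p:] * (smult (int N - int k) (pderiv f * E) + f * (?g * E' + pderiv E))"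
    unfolding power_deriv.simps G by (simp add: algebra_simps smult_add_right smult_diff_left smult_diff_right)
  then show ?case by (metis dvd_triv_left)
qed simp

lemma degree_power_deriv_le:
  assumes "degree f \<le> 3"
  shows "degree (power_deriv f N k h) \<le> degree h + 2 * k"
proof (induction k)
  case (Suc k)
  let ?g = "power_deriv f N k h"
  have "degree (pderiv f * ?g) \<le> (degree f - 1) + degree ?g"
    by (metis degree_mult_le degree_pderiv)
  moreover have "degree (f * pderiv ?g) \<le> degree ?g + 2"
  \<comment> \<open>In degree \<open>0\<close> the truncated \<open>degree ?g - 1\<close> would
    spoil the estimate, but there the derivative vanishes.\<close>
  proof (cases "degree ?g = 0")
    case True
    then have "pderiv ?g = 0" by (simp add: pderiv_eq_0_iff)
    then show ?thesis by simp
  next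
    case False
    have "degree (f * pderiv ?g) \<le> degree f + (degree ?g - 1)"
      by (metis degree_mult_le degree_pderiv)
    then show ?thesis using assms False by simp
  qed
  ultimately show ?case using Suc assms
    by (auto intro!: degree_add_le order.trans [OF degree_smult_le])
qed simp

section \<open>Lowering degrees by Fermat's little theorem\<close>

lemma fermat_int_power:
  assumes "prime p"
  shows "int p dvd x ^ (p * j) - x ^ j"
proof -
  define y where "y = nat (x mod int p)"
  have xy: "[x = int y] (mod int p)"
    using prime_gt_0_nat [OF assms] by (simp add: y_def cong_def)
  have "[y ^ p = y] (mod p)"
  proof (cases "p dvd y")
    case True
    then have "p dvd y ^ p" using prime_gt_0_nat [OF assms] by (simp add: dvd_power_iff dvd_trans [OF _ dvd_power])
    then show ?thesis using True by (simp add: cong_def)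
  next
    case False
    then have "[y ^ (p - 1) * y = 1 * y] (mod p)"
      using fermat_theorem [OF assms] by (intro cong_mult) auto
    then show ?thesis using prime_gt_0_nat [OF assms] by (metis mult_1 power_minus_mult)
  qed
  then have "[int y ^ p = int y] (mod int p)" by (metis cong_int_iff of_nat_power)
  then have "[x ^ p = x] (mod int p)"
    using xy by (meson cong_pow cong_sym cong_trans)
  then have "[(x ^ p) ^ j = x ^ j] (mod int p)" by (rule cong_pow)
  then show ?thesis by (simp add: cong_iff_dvd_diff power_mult)
qed

text \<open>Write \<open>n = i + p j\<close> with \<open>i < p\<close>. The factor
  \<open>x^(p j)\<close> passes through the derivatives as a constant, and its values agree with
  those of \<open>x^j\<close>. This drop in degree is what makes the linear system of Stepanov's
  method small.\<close>

lemma poly_power_deriv_monom_mod: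
  assumes p: "prime p"
  shows "int p dvd poly (power_deriv f N k (monom 1 n)) x
    - poly (power_deriv f N k (monom 1 (n mod p)) * monom 1 (n div p)) x"
proof -
  let ?M = "monom (1::int) (p * (n div p))" and ?g = "power_deriv f N k (monom 1 (n mod p))"
  have "[:int p:] dvd pderiv ?M"
    by (simp add: pderiv_monom const_poly_dvd_iff)
  from power_deriv_mult_const_mod [OF this, of f N k "monom 1 (n mod p)"]
  have "[:int p:] dvd power_deriv f N k (monom 1 n) - ?g * ?M"
    by (simp add: mult_monom add.commute)
  then obtain E where "power_deriv f N k (monom 1 n) - ?g * ?M = [:int p:] * E" by blast
  then have "poly (power_deriv f N k (monom 1 n) - ?g * ?M) x = poly ([:int p:] * E) x" by simp
  then have "int p dvd poly (power_deriv f N k (monom 1 n)) x - poly ?g x * x ^ (p * (n div p))"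
    by (simp add: poly_monom)
  moreover have "int p dvd poly ?g x * (x ^ (p * (n div p)) - x ^ (n div p))"
    using fermat_int_power [OF p] by simp
  ultimately have "int p dvd (poly (power_deriv f N k (monom 1 n)) x - poly ?g x * x ^ (p * (n div p)))
      + poly ?g x * (x ^ (p * (n div p)) - x ^ (n div p))"
    by (rule dvd_add)
  then show ?thesis by (simp add: algebra_simps poly_monom)
qed

text \<open>
  The coefficients of \<open>W\<close> sit at positions in \<open>[0, d)\<close> modulo \<open>p\<close>, and multiplication by
  \<open>monom 1 d\<close> moves those of \<open>V\<close> into the complementary gaps.
\<close>

lemma sparse_independent_mod:
  fixes W V H :: "int poly"
  assumes p: "prime p" "p = 2 * d + 1"
    and W: "\<And>n. d \<le> n mod p \<Longrightarrow> coeff W n = 0" and V: "\<And>n. d \<le> n mod p \<Longrightarrow> coeff V n = 0"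
    and H: "\<not> int p dvd coeff H 0"
    and zero: "[:int p:] dvd W + monom 1 d * (H * V)"
  shows "int p dvd coeff W n \<and> int p dvd coeff V n"
proof (induction n rule: less_induct)
  case (less n)
  have z: "int p dvd coeff W m + (if m < d then 0 else coeff (H * V) (m - d))" for m
    using zero [unfolded const_poly_dvd_iff, rule_format, of m]
    by (cases "m < d") (simp_all add: coeff_monom_mult)
  show ?case
  proof (cases "d \<le> n mod p")
    case True
    then show ?thesis using W V by simp
  next
    case False
    \<comment> \<open>Position \<open>n\<close> of the relation involves only coefficients of
      \<open>V\<close> below \<open>n\<close>, so it isolates the coefficient of
      \<open>W\<close>.\<close>
    have "int p dvd coeff (H * V) m" if "m < n" for m
      using less.IH that by (auto simp: coeff_mult intro!: dvd_sum)
    then have "int p dvd (if n < d then 0 else coeff (H * V) (n - d))"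
      using False by (cases "d = 0") auto
    then have Wn: "int p dvd coeff W n" using z [of n] by (simp add: dvd_add_left_iff)
    \<comment> \<open>Position \<open>n + d\<close> falls into a gap of \<open>W\<close>, as
      \<open>d <= n mod p + d < p\<close>. It gives the coefficient of \<open>H * V\<close> at
      \<open>n\<close>, in which only the term with the invertible \<open>H(0)\<close> is
      left.\<close>
    have "(n mod p + d) mod p = n mod p + d" using False p by simp
    then have "(n + d) mod p = n mod p + d" by (metis mod_add_left_eq)
    then have "int p dvd coeff (H * V) n" using z [of "n + d"] W [of "n + d"] by simp
    also have "coeff (H * V) n = (\<Sum>i<n. coeff V i * coeff H (n - i)) + coeff V n * coeff H 0"
      by (subst mult.commute) (simp add: coeff_mult lessThan_Suc_atMost [symmetric])
    finally have "int p dvd coeff V n * coeff H 0"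
      using less.IH by (subst (asm) dvd_add_right_iff) (auto intro!: dvd_sum)
    then show ?thesis using Wn H prime_dvd_mult_iff [of "int p"] p(1) by auto
  qed
qed

text \<open>
  The auxiliary polynomial is \<open>f^l W + f^(l+d) V\<close> with \<open>W\<close>, \<open>V\<close> as above. At a point with
  \<open>f(x)^d = a\<close> its \<open>k\<close>-th derivative agrees modulo \<open>p\<close> with a multiple of the low-degree polynomial
  obtained by replacing \<open>x^p\<close> by \<open>x\<close> and \<open>f^d\<close> by \<open>a\<close>; requiring the latter to vanish identically
  for \<open>k < l\<close> is a linear system with fewer equations than unknowns.
\<close>

lemma stepanov_bound:
  fixes h f :: "int poly" and a :: int
  assumes p: "prime p" "p = 2 * d + 1" and d: "d > 0"
    and f: "f = [:0, 1:] * h" "degree f \<le> 3" "lead_coeff f = 1" and h: "\<not> int p dvd coeff h 0"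
    and l: "l \<le> p" and J: "J > 0" and less: "l * (d + J) + l * l \<le> 2 * J * d" "l > 0"
  defines "R \<equiv> {x \<in> {0..<int p}. int p dvd poly f x \<or> int p dvd poly f x ^ d - a}"
  shows "l * card R \<le> 3 * (l + d) + J * p"
proof -
  define N where "N = {n. n < J * p \<and> n mod p < d}"
  have p0: "p > 0" and dp: "d < p" using p by auto
  have finN: "finite N" by (simp add: N_def)
  have "bij_betw (\<lambda>(j, i). j * p + i) ({..<J} \<times> {..<d}) N"
  proof (rule bij_betwI [where g = "\<lambda>n. (n div p, n mod p)"])
    show "(\<lambda>(j, i). j * p + i) \<in> {..<J} \<times> {..<d} \<rightarrow> N"
    proof (clarsimp simp: N_def)
      fix j i assume ji: "j < J" "i < d"
      have "j * p + i < Suc j * p" using ji dp by simp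
      also have "\<dots> \<le> J * p" using ji by (intro mult_right_mono) auto
      finally show "j * p + i < J * p \<and> i mod p < d" using ji dp by simp
    qed
    show "(\<lambda>n. (n div p, n mod p)) \<in> N \<rightarrow> {..<J} \<times> {..<d}"
      using p0 by (auto simp: N_def less_mult_imp_div_less)
  qed (use p0 dp in auto)
  then have cardN: "card N = J * d" by (metis bij_betw_same_card card_cartesian_product card_lessThan)
  \<comment> \<open>The unknowns are the coefficients of \<open>W\<close> (tag \<open>False\<close>)
    and of \<open>V\<close> (tag \<open>True\<close>). Equation \<open>(k, i)\<close> says that
    coefficient \<open>i\<close> of the reduced derivative \<open>E c k\<close> vanishes modulo
    \<open>p\<close>.\<close>
  define I where "I = N \<times> (UNIV :: bool set)"
  define K where "K = (SIGMA k:{..<l}. {..<d + J + 2 * k})"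
  define block where "block M k n = power_deriv f M k (monom 1 (n mod p)) * monom 1 (n div p)" for M k n
  define E where "E c k = (\<Sum>n\<in>N. smult (c (n, False)) (block l k n)) +
      (\<Sum>n\<in>N. smult (a * c (n, True)) (block (l + d) k n))" for c :: "nat \<times> bool \<Rightarrow> int" and k
  \<comment> \<open>The summand \<open>l\<close> on the left avoids truncated subtraction; as
    \<open>l > 0\<close>, it makes the comparison with the number of unknowns strict.\<close>
  have "(\<Sum>k<l. d + J + 2 * k) + l = l * (d + J) + l * l" for l
    by (induction l) (auto simp: algebra_simps)
  then have "card K + l = l * (d + J) + l * l"
    by (simp add: K_def)
  moreover have "card I = 2 * J * d"
    by (simp add: I_def cardN card_cartesian_product)
  ultimately have cardK: "card K < card I" using less by linarith
  have "\<exists>c. (\<exists>i\<in>I. \<not> int p dvd c i) \<and> (\<forall>k\<in>K. int p dvd (\<lambda>(k, i). coeff (E c k) i) k)"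
  proof (rule homogeneous_system_mod)
    show "p > 1" using p prime_gt_1_nat by blast
    fix c c' :: "nat \<times> bool \<Rightarrow> int" and k :: "nat \<times> nat"
    have "E (\<lambda>i. c i - c' i) k = E c k - E c' k" for k
      by (simp add: E_def smult_diff_left right_diff_distrib sum_subtractf)
    then show "(case k of (k, i) \<Rightarrow> coeff (E (\<lambda>i. c i - c' i) k) i) =
      (case k of (k, i) \<Rightarrow> coeff (E c k) i) - (case k of (k, i) \<Rightarrow> coeff (E c' k) i)"
      by (simp split: prod.split)
  qed (use cardK finN in \<open>auto simp: I_def K_def\<close>)
  then obtain c i0 where i0: "i0 \<in> I" "\<not> int p dvd c i0"
    and cK: "\<And>k i. (k, i) \<in> K \<Longrightarrow> int p dvd coeff (E c k) i"
    by fastforce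
  have "degree (block M k n) \<le> (d - 1) + (J - 1) + 2 * k" if "n \<in> N" for M k n
  proof -
    have "degree (block M k n) \<le> degree (power_deriv f M k (monom 1 (n mod p))) + n div p"
      unfolding block_def by (rule order.trans [OF degree_mult_le]) (simp add: degree_monom_eq)
    also have "\<dots> \<le> (n mod p + 2 * k) + n div p"
      using degree_power_deriv_le [OF f(2), of M k "monom 1 (n mod p)"] by (simp add: degree_monom_eq)
    finally have "degree (block M k n) \<le> (n mod p + 2 * k) + n div p" .
    moreover have "n mod p < d" "n div p < J"
      using that by (auto simp: N_def less_mult_imp_div_less)
    ultimately show ?thesis by simp
  qed
  then have degE': "degree (E c k) \<le> (d - 1) + (J - 1) + 2 * k" for k
    unfolding E_def
    by (intro degree_add_le degree_sum_le finN order.trans [OF degree_smult_le])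
  then have degE: "degree (E c k) < d + J + 2 * k" for k
    using J d degE' [of k] by linarith
  have Edvd: "[:int p:] dvd E c k" if "k < l" for k
    unfolding const_poly_dvd_iff
  proof
    fix i
    show "int p dvd coeff (E c k) i"
    proof (cases "i < d + J + 2 * k")
      case True
      then show ?thesis using cK that by (auto simp: K_def)
    next
      case False
      then show ?thesis using degE [of k] by (simp add: coeff_eq_0)
    qed
  qed
  define W where "W b = (\<Sum>n\<in>N. monom (c (n, b)) n)" for b
  have coeffW: "coeff (W b) n = (if n \<in> N then c (n, b) else 0)" for b n
    using finN by (simp add: W_def coeff_sum sum.delta)
  define P where "P = f ^ l * W False + f ^ (l + d) * W True"
  \<comment> \<open>Because \<open>f = x h\<close>, the factor \<open>f^d\<close> is
    \<open>x^d\<close> times \<open>h^d\<close>, whose constant term is invertible. Cancelling the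
    monic \<open>f^l\<close> leaves the sparse relation, which would force every coefficient in
    \<open>c\<close> to vanish modulo \<open>p\<close>.\<close>
  have notP: "\<not> [:int p:] dvd P"
  proof
    assume "[:int p:] dvd P"
    moreover have "f ^ d = monom 1 d * h ^ d"
      unfolding f(1) power_mult_distrib by (simp add: monom_altdef)
    then have "P = f ^ l * (W False + monom 1 d * (h ^ d * W True))"
      by (simp add: P_def power_add algebra_simps)
    moreover have "\<not> [:int p:] dvd f ^ l"
      using f p by (intro not_const_dvd_monic) (auto simp: lead_coeff_power)
    ultimately have "[:int p:] dvd W False + monom 1 d * (h ^ d * W True)"
      using prime_elem_dvd_mult_iff [OF prime_elem_const_int [OF p(1)]] by auto
    moreover have "\<not> int p dvd coeff (h ^ d) 0"
      using h prime_dvd_power [of "int p" "coeff h 0" d] p(1) by (auto simp: coeff_0_power)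
    moreover have "coeff (W b) n = 0" if "d \<le> n mod p" for b n
      using that by (simp add: coeffW N_def)
    ultimately have "int p dvd coeff (W False) n \<and> int p dvd coeff (W True) n" for n
      using sparse_independent_mod [OF p] by blast
    then have "int p dvd coeff (W b) n" for b n by (cases b) auto
    from this [of "snd i0" "fst i0"] show False using i0 by (auto simp: coeffW I_def)
  qed
  have W_eval: "int p dvd poly (power_deriv f M k (W b)) x - poly (\<Sum>n\<in>N. smult (c (n, b)) (block M k n)) x" for M k b x
  proof -
    have "W b = (\<Sum>n\<in>N. smult (c (n, b)) (monom 1 n))" by (simp add: W_def smult_monom)
    then have eq: "poly (power_deriv f M k (W b)) x - poly (\<Sum>n\<in>N. smult (c (n, b)) (block M k n)) x =
      (\<Sum>n\<in>N. c (n, b) * (poly (power_deriv f M k (monom 1 n)) x - poly (block M k n) x))"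
      by (simp add: power_deriv_sum power_deriv_smult poly_sum sum_subtractf right_diff_distrib)
    have "int p dvd poly (power_deriv f M k (monom 1 n)) x - poly (block M k n) x" for n
      unfolding block_def by (rule poly_power_deriv_monom_mod [OF p(1)])
    then show ?thesis unfolding eq by (simp add: dvd_sum)
  qed
  have van: "int p dvd poly ((pderiv ^^ k) P) x" if x: "x \<in> R" and k: "k < l" for x k
  proof -
    let ?w = "poly (power_deriv f l k (W False)) x" and ?v = "poly (power_deriv f (l + d) k (W True)) x"
    let ?w' = "poly (\<Sum>n\<in>N. smult (c (n, False)) (block l k n)) x"
    let ?v' = "poly (\<Sum>n\<in>N. smult (c (n, True)) (block (l + d) k n)) x"
    have ld: "l + d - k = (l - k) + d" using k by simp
    have "(pderiv ^^ k) P = f ^ (l - k) * power_deriv f l k (W False) +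
        f ^ (l + d - k) * power_deriv f (l + d) k (W True)"
      using k unfolding P_def higher_pderiv_add by (simp add: higher_pderiv_power_mult)
    then have eval: "poly ((pderiv ^^ k) P) x = poly f x ^ (l - k) * (?w + poly f x ^ d * ?v)"
      unfolding ld by (simp add: power_add algebra_simps)
    \<comment> \<open>At zeros of \<open>f\<close> the remaining power \<open>f^(l - k)\<close>
      vanishes, since \<open>k < l\<close>; elsewhere the bracket does, by the linear
      system.\<close>
    from x consider "int p dvd poly f x" | "int p dvd poly f x ^ d - a" by (auto simp: R_def)
    then show ?thesis
    proof cases
      case 1
      then have "int p dvd poly f x ^ (l - k)" using k by (meson dvd_power dvd_trans zero_less_diff)
      then show ?thesis unfolding eval by simp
    next
      case 2
      obtain G where "E c k = [:int p:] * G" using Edvd [OF k] by blast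
      then have "int p dvd poly (E c k) x" by simp
      also have "poly (E c k) x = ?w' + a * ?v'"
        by (simp add: E_def poly_sum sum_distrib_left mult.assoc)
      finally have E': "int p dvd ?w' + a * ?v'" .
      have w: "?w + poly f x ^ d * ?v = (?w' + a * ?v') + (?w - ?w') + a * (?v - ?v') + (poly f x ^ d - a) * ?v"
        by (simp add: algebra_simps)
      have "int p dvd ?w + poly f x ^ d * ?v"
        unfolding w
        by (rule dvd_add [OF dvd_add [OF dvd_add [OF E' W_eval] dvd_mult [OF W_eval]] dvd_mult2 [OF 2]])
      then show ?thesis unfolding eval by simp
    qed
  qed
  have "l * card R \<le> degree P"
    by (rule card_multiple_roots_mod_le [OF p(1) l notP _ van]) (auto simp: R_def)
  also have "degree P \<le> 3 * (l + d) + J * p"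
  proof -
    have "degree (W b) \<le> J * p" for b
      unfolding W_def using finN
      by (intro degree_sum_le) (auto intro: order.trans [OF degree_monom_le] simp: N_def)
    moreover have "degree (f ^ m) \<le> 3 * (l + d)" if "m \<le> l + d" for m
      using degree_power_le [of f m] mult_le_mono [OF f(2) that] by linarith
    ultimately show ?thesis unfolding P_def
      by (intro degree_add_le order.trans [OF degree_mult_le] add_mono) auto
  qed
  finally show ?thesis .
qed

section \<open>Sums of Legendre symbols\<close>

locale odd_prime =
  fixes p :: nat
  assumes prime_p: "prime p" and p_gt_2: "2 < p"
begin

section \<open>The Legendre symbol as a function on integers modulo \<open>p\<close>\<close>

definition chi :: "int \<Rightarrow> int" where "chi x = Legendre x (int p)"

definition F :: "int set" where "F = {0..<int p}"

lemma finite_F [simp]: "finite F" and card_F [simp]: "card F = p"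
  by (simp_all add: F_def)

lemma prime_dvd_mult: "int p dvd x * y \<longleftrightarrow> int p dvd x \<or> int p dvd y"
  using prime_p by (simp add: prime_dvd_mult_iff)

lemma not_dvd_2: "\<not> int p dvd 2"
  using p_gt_2 zdvd_imp_le by fastforce

lemma chi_cong: "int p dvd x - y \<Longrightarrow> chi x = chi y"
proof -
  assume "int p dvd x - y"
  then have "[x = z] (mod int p) \<longleftrightarrow> [y = z] (mod int p)" "[z = x] (mod int p) \<longleftrightarrow> [z = y] (mod int p)" for z
    by (meson cong_iff_dvd_diff cong_sym cong_trans)+
  then show ?thesis by (simp add: chi_def Legendre_def QuadRes_def)
qed

lemma chi_cases: "chi x = 0 \<or> chi x = 1 \<or> chi x = -1"
  by (simp add: chi_def Legendre_def)

lemma chi_eq_0_iff: "chi x = 0 \<longleftrightarrow> int p dvd x"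
  by (simp add: chi_def Legendre_def cong_0_iff)

lemma chi_0 [simp]: "chi 0 = 0"
  by (simp add: chi_eq_0_iff)

lemma abs_chi_le: "\<bar>chi x\<bar> \<le> 1"
  using chi_cases [of x] by auto

lemma chi_euler: "int p dvd x ^ ((p - 1) div 2) - chi x"
  using euler_criterion [OF prime_p p_gt_2, of x]
  by (simp add: chi_def cong_iff_dvd_diff dvd_diff_commute)

text \<open>Two integers in \<open>[-1, 1]\<close> differ by at most \<open>2 < p\<close>, so a
  congruence modulo \<open>p\<close> between them is an equality.\<close>

lemma chi_eqI: "int p dvd chi x - y \<Longrightarrow> \<bar>y\<bar> \<le> 1 \<Longrightarrow> chi x = y"
proof (rule ccontr)
  assume y: "int p dvd chi x - y" "\<bar>y\<bar> \<le> 1" "chi x \<noteq> y"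
  then have "\<bar>int p\<bar> \<le> \<bar>chi x - y\<bar>" by (intro dvd_imp_le_int) auto
  then show False using y(2) abs_chi_le [of x] p_gt_2 by linarith
qed

lemma chi_mult: "chi (x * y) = chi x * chi y"
proof (rule chi_eqI)
  let ?d = "(p - 1) div 2"
  have "int p dvd (x ^ ?d - chi x) * y ^ ?d + chi x * (y ^ ?d - chi y) - ((x * y) ^ ?d - chi (x * y))"
    by (intro dvd_add dvd_diff dvd_mult dvd_mult2 chi_euler)
  then show "int p dvd chi (x * y) - chi x * chi y"
    by (simp add: algebra_simps power_mult_distrib)
  show "\<bar>chi x * chi y\<bar> \<le> 1" using chi_cases [of x] chi_cases [of y] by auto
qed

lemma chi_1 [simp]: "chi 1 = 1"
  by (rule chi_eqI) (use chi_euler [of 1] in \<open>simp_all add: dvd_diff_commute\<close>)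

lemma chi_square: "chi (x\<^sup>2) = of_bool (\<not> int p dvd x)"
  using chi_cases [of x] chi_eq_0_iff [of x] by (auto simp: power2_eq_square chi_mult)

text \<open>The point of order two at the origin of \<open>y^2 = x (x^2 + B x + C)\<close> supplies
  the factorisation \<open>f = x h\<close> with \<open>h(0) = C\<close> that Stepanov's method uses
  above. Squaring keeps the bound \<open>|S| <= 40 sqrt p\<close> inside the integers.\<close>

lemma weil_bound_even_torsion:
  assumes C: "\<not> int p dvd C"
  shows "(\<Sum>x\<in>F. chi (x * (x\<^sup>2 + B * x + C)))\<^sup>2 \<le> 1600 * int p"
proof -
  define h where "h = [:C, B, 1:]"
  define f where "f = [:0, 1:] * h"
  define S where "S = (\<Sum>x\<in>F. chi (x * (x\<^sup>2 + B * x + C)))"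
  have f: "poly f x = x * (x\<^sup>2 + B * x + C)" for x
    by (simp add: f_def h_def power2_eq_square algebra_simps)
  have pos: "int p > 0" using p_gt_2 by simp
  have "\<bar>S\<bar> \<le> (\<Sum>x\<in>F. 1)"
    unfolding S_def by (rule order.trans [OF sum_abs sum_mono]) (rule abs_chi_le)
  then have triv: "\<bar>S\<bar> \<le> int p" by simp
  show ?thesis
  \<comment> \<open>Up to \<open>16\<close> the trivial bound \<open>|S| <= p\<close> suffices;
    beyond it \<open>n >= 4\<close>, hence \<open>4 n <= n^2\<close>.\<close>
  proof (cases "p \<le> 16")
    case True
    have "S\<^sup>2 \<le> (int p)\<^sup>2" using triv by (simp add: abs_le_square_iff [symmetric])
    also have "\<dots> \<le> 1600 * int p" using True by (simp add: power2_eq_square mult_right_mono)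
    finally show ?thesis by (simp add: S_def)
  next
    case False
    define d where "d = (p - 1) div 2"
    have "odd p" using prime_p p_gt_2 prime_odd_nat by blast
    then have pd: "p = 2 * d + 1" by (auto simp: d_def elim!: oddE)
    \<comment> \<open>Multiplicity \<open>l = 2 n\<close> and \<open>J = n + 12\<close>: beyond the common \<open>2 n d\<close> there are \<open>24 d\<close>
      unknowns against at most \<open>6 n^2 + 24 n\<close> equations.\<close>
    define n where "n = floor_sqrt (p - 1)"
    have n1: "n * n \<le> p - 1" using floor_sqrt_power2_le [of "p - 1"] by (simp add: n_def power2_eq_square)
    have n2: "p - 1 < Suc n * Suc n"
      using Suc_floor_sqrt_power2_gt [of "p - 1"] by (simp add: n_def power2_eq_square)
    have n4: "4 \<le> n"
    proof (rule ccontr)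
      assume "\<not> 4 \<le> n"
      then have "Suc n * Suc n \<le> 4 * 4" by (intro mult_le_mono) auto
      then show False using n2 False by simp
    qed
    have n4': "4 * n \<le> n * n" using n4 by simp
    have bound: "2 * n * card {x \<in> {0..<int p}. int p dvd poly f x \<or> int p dvd poly f x ^ d - a}
        \<le> 3 * (2 * n + d) + (n + 12) * p" for a
    proof (rule stepanov_bound [where h = h])
      show "2 * n * (d + (n + 12)) + 2 * n * (2 * n) \<le> 2 * (n + 12) * d"
      proof -
        \<comment> \<open>Here \<open>24 n <= 6 n^2\<close>, and
          \<open>12 n^2 <= 12 (p - 1) = 24 d\<close>.\<close>
        have "6 * (n * n) + 24 * n \<le> 24 * d" using n1 n4' pd by linarith
        then show ?thesis by (simp add: algebra_simps)
      qed
      show "2 * n \<le> p" using n1 n4' by linarith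
    qed (use prime_p pd C n1 n4' n4 p_gt_2 in \<open>auto simp: f_def h_def\<close>)
    \<comment> \<open>By Euler's criterion \<open>R\<close> contains every zero of \<open>f\<close>
      and every point with symbol \<open>e\<close>. Points outside \<open>R\<close> contribute
      \<open>-1\<close> to \<open>e * S\<close>, so \<open>e * S <= 2 |R| - p\<close>; the two signs
      bound \<open>S\<close> from both sides.\<close>
    have side: "int n * (e * S) \<le> 20 * int p" if e: "e = 1 \<or> e = -1" for e
    proof -
      define R where "R = {x \<in> F. int p dvd poly f x \<or> int p dvd poly f x ^ d - e}"
      have "e * chi (poly f x) \<le> 2 * of_bool (x \<in> R) - 1" if "x \<in> F" for x
      proof (cases "x \<in> R")
        case True
        then show ?thesis using e chi_cases [of "poly f x"] by auto
      next
        case False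
        then have "chi (poly f x) \<noteq> 0" "chi (poly f x) \<noteq> e"
          using that chi_euler [of "poly f x"] by (auto simp: R_def chi_eq_0_iff d_def)
        then show ?thesis using False e chi_cases [of "poly f x"] by auto
      qed
      then have "(\<Sum>x\<in>F. e * chi (poly f x)) \<le> (\<Sum>x\<in>F. 2 * of_bool (x \<in> R) - 1)"
        by (rule sum_mono)
      also have "\<dots> = 2 * int (card R) - int p"
        by (simp add: sum_subtractf sum_distrib_left [symmetric] R_def Int_def of_bool_def
            sum.If_cases conj_commute)
      also have "(\<Sum>x\<in>F. e * chi (poly f x)) = e * S" by (simp add: S_def f sum_distrib_left)
      finally have "int n * (e * S) \<le> int n * (2 * int (card R) - int p)"
        by (intro mult_left_mono) auto
      moreover have "2 * int n * int (card R) \<le> 3 * (2 * int n + int d) + (int n + 12) * int p"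
        using bound [of e] unfolding R_def F_def
        by (metis (no_types, lifting) of_nat_add of_nat_le_iff of_nat_mult of_nat_numeral)
      moreover have "int n \<le> int p" using n1 n4' n4 by linarith
      \<comment> \<open>The main term \<open>n p\<close> of the Stepanov bound cancels, leaving
        \<open>6 n + 3 d + 12 p\<close>.\<close>
      ultimately show ?thesis using pd n1 n4' by (simp add: algebra_simps)
    qed
    have "\<bar>int n * S\<bar> \<le> 20 * int p" using side [of 1] side [of "-1"] by simp
    then have "(int n * S)\<^sup>2 \<le> (20 * int p)\<^sup>2"
      by (subst power2_abs [symmetric]) (rule power_mono, auto)
    then have nS: "int n * int n * S\<^sup>2 \<le> 400 * (int p)\<^sup>2" by (simp only: power_mult_distrib power2_eq_square) (simp add: mult_ac)
    \<comment> \<open>The estimate \<open>p <= 4 n^2\<close> trades \<open>n^2\<close> for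
      \<open>p\<close>, which gives \<open>1600 = 4 * 400\<close>.\<close>
    have "Suc n * Suc n \<le> (2 * n) * (2 * n)" using n4 by (intro mult_le_mono) auto
    then have "p \<le> 4 * (n * n)" using n2 by simp
    then have "int p \<le> 4 * (int n * int n)" by (metis of_nat_le_iff of_nat_mult of_nat_numeral)
    then have "int p * S\<^sup>2 \<le> 4 * (int n * int n) * S\<^sup>2" by (intro mult_right_mono) auto
    also have "\<dots> \<le> int p * (1600 * int p)" using nS by (simp add: power2_eq_square algebra_simps)
    finally show ?thesis using pos by (simp add: S_def)
  qed
qed

section \<open>Substitutions and root counts modulo \<open>p\<close>\<close>

lemma congruent_mod: "(\<And>x y. int p dvd x - y \<Longrightarrow> g x = g y) \<Longrightarrow> g (x mod int p) = g x"
proof -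
  assume g: "\<And>x y. int p dvd x - y \<Longrightarrow> g x = g y"
  show "g (x mod int p) = g x" by (rule g) (simp add: mod_eq_dvd_iff [symmetric])
qed

lemma sum_F_affine:
  fixes g :: "int \<Rightarrow> 'a :: comm_monoid_add"
  assumes c: "\<not> int p dvd c" and g: "\<And>x y. int p dvd x - y \<Longrightarrow> g x = g y"
  shows "(\<Sum>x\<in>F. g (c * x + e)) = (\<Sum>x\<in>F. g x)"
proof -
  let ?a = "\<lambda>x. (c * x + e) mod int p"
  have "inj_on ?a F"
  proof (rule inj_onI)
    fix x y assume xy: "x \<in> F" "y \<in> F" "?a x = ?a y"
    then have "int p dvd c * (x - y)" by (simp add: mod_eq_dvd_iff algebra_simps)
    then have "int p dvd x - y" using c by (simp add: prime_dvd_mult)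
    then have "x mod int p = y mod int p" by (simp add: mod_eq_dvd_iff)
    then show "x = y" using xy by (simp add: F_def)
  qed
  moreover have "?a ` F \<subseteq> F" using p_gt_2 by (auto simp: F_def)
  ultimately have "bij_betw ?a F F" by (simp add: bij_betw_def endo_inj_surj)
  then have "(\<Sum>x\<in>F. g x) = (\<Sum>x\<in>F. g (?a x))" by (rule sum.reindex_bij_betw [symmetric])
  also have "\<dots> = (\<Sum>x\<in>F. g (c * x + e))" by (intro sum.cong refl congruent_mod g)
  finally show ?thesis ..
qed

lemma sum_F_zero: "(\<Sum>x\<in>F. of_bool (int p dvd x) * g x) = (g 0 :: int)"
proof -
  have "of_bool (int p dvd x) * g x = (if x = 0 then g 0 else 0)" if "x \<in> F" for x
    using that zdvd_not_zless [of x "int p"] by (auto simp: F_def)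
  then have "(\<Sum>x\<in>F. of_bool (int p dvd x) * g x) = (\<Sum>x\<in>F. if x = 0 then g 0 else 0)"
    by (intro sum.cong) auto
  also have "\<dots> = g 0" using p_gt_2 by (simp add: sum.delta' F_def)
  finally show ?thesis .
qed

text \<open>An invertible linear congruence has one solution class, so its indicator collapses a
  sum. Double sums below are created and removed this way.\<close>

lemma sum_F_pick:
  fixes g :: "int \<Rightarrow> int"
  assumes c: "\<not> int p dvd c" and t: "int p dvd c * t + e"
    and g: "\<And>x y. int p dvd x - y \<Longrightarrow> g x = g y"
  shows "(\<Sum>x\<in>F. of_bool (int p dvd c * x + e) * g x) = g t"
proof -
  have *: "int p dvd c * x + e \<longleftrightarrow> int p dvd x - t" for x
  proof -
    have "int p dvd c * x + e \<longleftrightarrow> int p dvd (c * x + e) - (c * t + e)"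
      using t by (metis dvd_diff_left_iff)
    also have "(c * x + e) - (c * t + e) = c * (x - t)" by (simp add: algebra_simps)
    finally show ?thesis using c by (simp add: prime_dvd_mult)
  qed
  have "(\<Sum>x\<in>F. of_bool (int p dvd c * x + e) * g x) = (\<Sum>x\<in>F. of_bool (int p dvd x - t) * g x)"
    by (simp only: *)
  also have "\<dots> = (\<Sum>x\<in>F. of_bool (int p dvd (1 * x + t) - t) * g (1 * x + t))"
  proof (rule sum_F_affine [symmetric])
    fix x y assume xy: "int p dvd x - y"
    have "int p dvd x - t \<longleftrightarrow> int p dvd (x - t) - (x - y)" using xy by (metis dvd_diff_left_iff)
    then show "of_bool (int p dvd x - t) * g x = of_bool (int p dvd y - t) * g y"
      using g [OF xy] by simp
  qed (use p_gt_2 in auto)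
  also have "\<dots> = (\<Sum>x\<in>F. of_bool (int p dvd x) * g (x + t))" by simp
  also have "\<dots> = g t" by (subst sum_F_zero) simp
  finally show ?thesis .
qed

lemma ex_solution: "\<not> int p dvd c \<Longrightarrow> \<exists>t. int p dvd c * t + e"
proof -
  assume "\<not> int p dvd c"
  then have "coprime c (int p)"
    using prime_p by (metis coprime_commute prime_imp_coprime prime_nat_int_transfer)
  then obtain t where "[c * t = 1] (mod int p)" using cong_solve_coprime_int by blast
  then have "int p dvd (c * t - 1) * (- e)" by (simp add: cong_iff_dvd_diff)
  then have "int p dvd c * (t * (- e)) + e" by (simp add: algebra_simps)
  then show ?thesis by blast
qed

lemma count_linear: "\<not> int p dvd c \<Longrightarrow> (\<Sum>x\<in>F. of_bool (int p dvd c * x + e)) = (1 :: int)"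
  using ex_solution [of c e] sum_F_pick [of c _ e "\<lambda>_. 1"] by auto

lemma count_square: "(\<Sum>y\<in>F. of_bool (int p dvd y\<^sup>2 - u)) = 1 + chi u"
proof -
  consider (zero) "int p dvd u" | (res) z where "\<not> int p dvd u" "int p dvd z\<^sup>2 - u"
    | (non) "\<not> int p dvd u" "\<And>z. \<not> int p dvd z\<^sup>2 - u" by blast
  then show ?thesis
  proof cases
    case zero
    then have "int p dvd y\<^sup>2 - u \<longleftrightarrow> int p dvd 1 * y + 0" for y
      by (simp add: dvd_diff_left_iff power2_eq_square prime_dvd_mult)
    then show ?thesis using zero count_linear [of 1 0] p_gt_2 by (simp add: chi_eq_0_iff [symmetric])
  next
    case res
    have z0: "\<not> int p dvd z"
    proof
      assume "int p dvd z"
      then have "int p dvd z\<^sup>2" by (simp add: power2_eq_square)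
      then show False using res by (simp add: dvd_diff_right_iff)
    qed
    have "chi u = chi (z\<^sup>2)" using res(2) by (intro chi_cong) (simp add: dvd_diff_commute)
    then have chi: "chi u = 1" using z0 by (simp add: chi_square)
    have sq: "int p dvd y\<^sup>2 - u \<longleftrightarrow> int p dvd 1 * y + - z \<or> int p dvd 1 * y + z" for y
    proof -
      have "int p dvd y\<^sup>2 - u \<longleftrightarrow> int p dvd (y\<^sup>2 - u) - (z\<^sup>2 - u)" using res by (metis dvd_diff_left_iff)
      also have "(y\<^sup>2 - u) - (z\<^sup>2 - u) = (1 * y + - z) * (1 * y + z)" by (simp add: power2_eq_square algebra_simps)
      finally show ?thesis by (simp only: prime_dvd_mult)
    qed
    have "\<not> (int p dvd 1 * y + - z \<and> int p dvd 1 * y + z)" for y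
    proof
      assume "int p dvd 1 * y + - z \<and> int p dvd 1 * y + z"
      then have "int p dvd (1 * y + z) - (1 * y + - z)" by (intro dvd_diff) auto
      then have "int p dvd 2 * z" by (simp add: algebra_simps)
      then show False using z0 not_dvd_2 prime_dvd_mult by blast
    qed
    then have split: "of_bool (int p dvd y\<^sup>2 - u) = of_bool (int p dvd 1 * y + - z) + (of_bool (int p dvd 1 * y + z) :: int)" for y
      unfolding sq by auto
    have "(\<Sum>y\<in>F. of_bool (int p dvd y\<^sup>2 - u)) =
        (\<Sum>y\<in>F. of_bool (int p dvd 1 * y + - z)) + (\<Sum>y\<in>F. of_bool (int p dvd 1 * y + z) :: int)"
      unfolding split by (rule sum.distrib)
    also have "\<dots> = 1 + 1" using p_gt_2 by (intro arg_cong2 [where f = "(+)"] count_linear) auto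
    finally show ?thesis using chi by simp
  next
    case non
    then have "chi u = -1" by (simp add: chi_def Legendre_def QuadRes_def cong_iff_dvd_diff)
    then show ?thesis using non by simp
  qed
qed

text \<open>Multiply by \<open>4 A\<close> and complete the square; \<open>y\<close> to
  \<open>2 A y + B\<close> permutes the residues.\<close>

lemma count_quadratic:
  assumes A: "\<not> int p dvd A"
  shows "(\<Sum>y\<in>F. of_bool (int p dvd A * y\<^sup>2 + B * y + C)) = 1 + chi (B\<^sup>2 - 4 * A * C)"
proof -
  let ?D = "B\<^sup>2 - 4 * A * C"
  have "\<not> int p dvd 4" using not_dvd_2 prime_dvd_mult [of 2 2] by simp
  then have "int p dvd A * y\<^sup>2 + B * y + C \<longleftrightarrow> int p dvd (4 * A) * (A * y\<^sup>2 + B * y + C)" for y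
    using A by (simp add: prime_dvd_mult)
  moreover have "(4 * A) * (A * y\<^sup>2 + B * y + C) = ((2 * A) * y + B)\<^sup>2 - ?D" for y
    by (simp add: power2_eq_square algebra_simps)
  ultimately have "(\<Sum>y\<in>F. of_bool (int p dvd A * y\<^sup>2 + B * y + C)) =
      (\<Sum>y\<in>F. of_bool (int p dvd ((2 * A) * y + B)\<^sup>2 - ?D) :: int)"
    by (simp only:)
  also have "\<dots> = (\<Sum>y\<in>F. of_bool (int p dvd y\<^sup>2 - ?D))"
  proof (rule sum_F_affine)
    fix x y assume "int p dvd x - y"
    then have "int p dvd (x - y) * (x + y)" by simp
    then have "int p dvd (x\<^sup>2 - ?D) - (y\<^sup>2 - ?D)" by (simp add: power2_eq_square algebra_simps)
    then have "int p dvd x\<^sup>2 - ?D \<longleftrightarrow> int p dvd y\<^sup>2 - ?D"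
      by (metis dvd_diff_left_iff dvd_diff_right_iff)
    then show "of_bool (int p dvd x\<^sup>2 - ?D) = (of_bool (int p dvd y\<^sup>2 - ?D) :: int)" by simp
  qed (use A not_dvd_2 in \<open>simp add: prime_dvd_mult\<close>)
  finally show ?thesis by (simp add: count_square)
qed

lemma sum_over_squares:
  fixes g :: "int \<Rightarrow> int"
  assumes g: "\<And>x y. int p dvd x - y \<Longrightarrow> g x = g y"
  shows "(\<Sum>b\<in>F. g (b\<^sup>2)) = (\<Sum>u\<in>F. (1 + chi u) * g u)"
proof -
  have "(\<Sum>b\<in>F. g (b\<^sup>2)) = (\<Sum>b\<in>F. \<Sum>u\<in>F. of_bool (int p dvd b\<^sup>2 - u) * g u)"
  proof (rule sum.cong [OF refl])
    fix b
    have "g (b\<^sup>2) = (\<Sum>u\<in>F. of_bool (int p dvd (- 1) * u + b\<^sup>2) * g u)"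
      by (rule sum_F_pick [symmetric]) (use p_gt_2 g in auto)
    then show "g (b\<^sup>2) = (\<Sum>u\<in>F. of_bool (int p dvd b\<^sup>2 - u) * g u)" by simp
  qed
  also have "\<dots> = (\<Sum>u\<in>F. (\<Sum>b\<in>F. of_bool (int p dvd b\<^sup>2 - u)) * g u)"
    by (subst sum.swap) (simp only: sum_distrib_right)
  finally show ?thesis by (simp add: count_square)
qed

section \<open>Evaluation of complete character sums\<close>

lemma sum_chi [simp]: "(\<Sum>x\<in>F. chi x) = 0"
  \<comment> \<open>Counting residues by their squares gives
    \<open>p = p + (sum of chi)\<close>.\<close>
  using sum_over_squares [of "\<lambda>_. 1"] by (simp add: sum.distrib)

lemma sum_chi_linear: "\<not> int p dvd c \<Longrightarrow> (\<Sum>x\<in>F. chi (c * x + e)) = 0"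
  using sum_F_affine [of c chi e] chi_cong by simp

text \<open>This writes \<open>chi (e c)\<close> as \<open>chi (e / c)\<close> and makes the ratio
  \<open>v\<close> a summation variable. It survives \<open>c = 0\<close>: then every
  \<open>v\<close> or none is counted, and \<open>chi\<close> sums to zero.\<close>

lemma sum_chi_ratio: "(\<Sum>v\<in>F. of_bool (int p dvd e - v * c) * chi v) = chi (e * c)"
proof (cases "int p dvd c")
  case True
  have iff: "int p dvd e - v * c \<longleftrightarrow> int p dvd e" for v
    by (rule dvd_diff_left_iff) (use True in simp)
  have "(\<Sum>v\<in>F. of_bool (int p dvd e - v * c) * chi v) = of_bool (int p dvd e) * (\<Sum>v\<in>F. chi v)"
    unfolding iff by (rule sum_distrib_left [symmetric])
  also have "\<dots> = chi (e * c)" using True by (simp add: chi_eq_0_iff [THEN iffD2])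
  finally show ?thesis .
next
  case False
  then obtain t where t: "int p dvd (- c) * t + e" using ex_solution [of "- c" e] by auto
  have "(\<Sum>v\<in>F. of_bool (int p dvd e - v * c) * chi v) = (\<Sum>v\<in>F. of_bool (int p dvd (- c) * v + e) * chi v)"
    by (simp add: algebra_simps)
  also have "\<dots> = chi t" by (rule sum_F_pick) (use False t in \<open>auto intro: chi_cong\<close>)
  also have "\<dots> = chi (t * c\<^sup>2)" using False by (simp add: chi_mult chi_square)
  also have "\<dots> = chi (e * c)"
  proof (rule chi_cong)
    have "int p dvd ((- c) * t + e) * (- c)" using t by (rule dvd_mult2)
    then show "int p dvd t * c\<^sup>2 - e * c" by (simp add: power2_eq_square algebra_simps)
  qed
  finally show ?thesis .
qed

text \<open>Group the \<open>x\<close> by the ratio \<open>v\<close> of the two factors. The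
  determinant is invertible, so each \<open>v\<close> occurs for exactly one \<open>x\<close>,
  except the value at infinity \<open>a / c\<close>, which is missed and accounts for the
  result.\<close>

lemma sum_chi_two_linear:
  assumes "\<not> int p dvd a * e - b * c"
  shows "(\<Sum>x\<in>F. chi ((a * x + b) * (c * x + e))) = - chi (a * c)"
proof -
  have "(\<Sum>x\<in>F. chi ((a * x + b) * (c * x + e))) =
      (\<Sum>x\<in>F. \<Sum>v\<in>F. of_bool (int p dvd (a * x + b) - v * (c * x + e)) * chi v)"
    by (simp only: sum_chi_ratio)
  also have "\<dots> = (\<Sum>v\<in>F. (\<Sum>x\<in>F. of_bool (int p dvd (a * x + b) - v * (c * x + e))) * chi v)"
    by (subst sum.swap) (simp only: sum_distrib_right)
  also have "\<dots> = (\<Sum>v\<in>F. (1 - of_bool (int p dvd a - v * c)) * chi v)"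
  proof (rule sum.cong [OF refl])
    fix v
    have lin: "(a * x + b) - v * (c * x + e) = (a - v * c) * x + (b - v * e)" for x
      by (simp add: algebra_simps)
    have "(\<Sum>x\<in>F. of_bool (int p dvd (a - v * c) * x + (b - v * e))) = 1 - (of_bool (int p dvd a - v * c) :: int)"
    proof (cases "int p dvd a - v * c")
      case True
      have "\<not> int p dvd b - v * e"
      proof
        assume "int p dvd b - v * e"
        then have "int p dvd (a - v * c) * e - (b - v * e) * c" using True by (intro dvd_diff) auto
        then show False using assms by (simp add: algebra_simps)
      qed
      then show ?thesis using True by (simp add: dvd_add_right_iff)
    next
      case False
      then show ?thesis using count_linear [OF False, of "b - v * e"] by simp
    qed
    then show "(\<Sum>x\<in>F. of_bool (int p dvd (a * x + b) - v * (c * x + e))) * chi v =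
        (1 - of_bool (int p dvd a - v * c)) * chi v"
      unfolding lin by simp
  qed
  also have "\<dots> = - chi (a * c)"
    by (simp add: left_diff_distrib sum_subtractf sum_chi_ratio)
  finally show ?thesis .
qed

text \<open>Put \<open>t = w + 1/w\<close>. Then \<open>A (w^2 + 1) + B w = w (A t + B)\<close>, the
  square \<open>w^2\<close> drops out of \<open>chi\<close>, and \<open>t\<close> arises from
  \<open>1 + chi (t^2 - 4)\<close> values of \<open>w\<close>, the roots of
  \<open>w^2 - t w + 1\<close>.\<close>

lemma sum_chi_reciprocal:
  "(\<Sum>w\<in>F. chi (s * w * (A * (w\<^sup>2 + 1) + B * w))) =
   (\<Sum>t\<in>F. (1 + chi (t\<^sup>2 - 4)) * chi (s * (A * t + B)))"
proof -
  have "chi (s * w * (A * (w\<^sup>2 + 1) + B * w)) =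
      (\<Sum>t\<in>F. of_bool (int p dvd 1 * w\<^sup>2 + (- t) * w + 1) * chi (s * (A * t + B)))" for w
  proof (cases "int p dvd w")
    case True
    have "\<not> int p dvd 1 * w\<^sup>2 + (- t) * w + 1" for t
    proof -
      have "int p dvd w * (w - t)" using True by simp
      then have "int p dvd 1 * w\<^sup>2 + (- t) * w" by (simp add: power2_eq_square algebra_simps)
      then show ?thesis using p_gt_2 by (simp only: dvd_add_right_iff) simp
    qed
    then show ?thesis using True by (simp add: chi_eq_0_iff)
  next
    case False
    then obtain t where t: "int p dvd (- w) * t + (w\<^sup>2 + 1)" using ex_solution [of "- w"] by auto
    have "(\<Sum>t\<in>F. of_bool (int p dvd 1 * w\<^sup>2 + (- t) * w + 1) * chi (s * (A * t + B))) =
        (\<Sum>t\<in>F. of_bool (int p dvd (- w) * t + (w\<^sup>2 + 1)) * chi (s * (A * t + B)))"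
      by (simp add: algebra_simps)
    also have "\<dots> = chi (s * (A * t + B))"
    proof (rule sum_F_pick)
      fix x y assume "int p dvd x - y"
      then have "int p dvd (x - y) * (s * A)" by simp
      then show "chi (s * (A * x + B)) = chi (s * (A * y + B))"
        by (intro chi_cong) (simp add: algebra_simps)
    qed (use False t in auto)
    also have "\<dots> = chi (s * (A * t + B) * w\<^sup>2)" using False by (simp add: chi_mult chi_square)
    also have "\<dots> = chi (s * w * (A * (w\<^sup>2 + 1) + B * w))"
    proof (rule chi_cong)
      have "int p dvd ((- w) * t + (w\<^sup>2 + 1)) * (- (s * w * A))" using t by (rule dvd_mult2)
      then show "int p dvd s * (A * t + B) * w\<^sup>2 - s * w * (A * (w\<^sup>2 + 1) + B * w)"
        by (simp add: power2_eq_square algebra_simps)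
    qed
    finally show ?thesis ..
  qed
  then have "(\<Sum>w\<in>F. chi (s * w * (A * (w\<^sup>2 + 1) + B * w))) =
      (\<Sum>w\<in>F. \<Sum>t\<in>F. of_bool (int p dvd 1 * w\<^sup>2 + (- t) * w + 1) * chi (s * (A * t + B)))"
    by (simp only:)
  also have "\<dots> = (\<Sum>t\<in>F. (\<Sum>w\<in>F. of_bool (int p dvd 1 * w\<^sup>2 + (- t) * w + 1)) * chi (s * (A * t + B)))"
    by (subst sum.swap) (simp only: sum_distrib_right)
  also have "\<dots> = (\<Sum>t\<in>F. (1 + chi (t\<^sup>2 - 4)) * chi (s * (A * t + B)))"
    using p_gt_2 by (subst count_quadratic) auto
  finally show ?thesis .
qed

section \<open>Clausen's identity up to a bounded multiple of the prime\<close>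

text \<open>After \<open>x = s y\<close>, the pairs are sorted by \<open>v = q(s y) / q(y)\<close>.
  The number \<open>N s v\<close> of such \<open>y\<close> is a root count for a quadratic with
  discriminant \<open>4 * D s v\<close>. The error comes only from \<open>v = s^2\<close>, where the
  leading coefficient vanishes.\<close>

lemma square_of_cubic_sum:
  assumes \<gamma>: "\<not> int p dvd \<gamma>"
  shows "\<bar>(\<Sum>x\<in>F. chi (x * (x\<^sup>2 + 2 * \<beta> * x + \<gamma>)))\<^sup>2 -
    (\<Sum>s\<in>F. \<Sum>v\<in>F. chi s * chi v * (1 + chi (\<beta>\<^sup>2 * (s - v)\<^sup>2 - \<gamma> * (s\<^sup>2 - v) * (1 - v))))\<bar>
    \<le> 4 * int p"
proof -
  define q where "q x = x\<^sup>2 + 2 * \<beta> * x + \<gamma>" for x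
  define D where "D s v = \<beta>\<^sup>2 * (s - v)\<^sup>2 - \<gamma> * (s\<^sup>2 - v) * (1 - v)" for s v
  define N where "N s v = (\<Sum>y\<in>F. of_bool (int p dvd q (s * y) - v * q y) :: int)" for s v
  have q_cong: "int p dvd q x - q y" if "int p dvd x - y" for x y
  proof -
    have "q x - q y = (x - y) * (x + y + 2 * \<beta>)" by (simp add: q_def power2_eq_square algebra_simps)
    then show ?thesis using that by simp
  qed
  \<comment> \<open>For invertible \<open>y\<close> substitute \<open>x = s y\<close>, which leaves
    the square \<open>y^2\<close>. For \<open>y = 0\<close> both sides vanish, the right one because
    \<open>q (s y)\<close> does not depend on \<open>s\<close> and \<open>chi\<close> sums to
    zero.\<close>
  have row: "(\<Sum>x\<in>F. chi (y * q y) * chi (x * q x)) = (\<Sum>s\<in>F. chi s * chi (q (s * y) * q y))" for y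
  proof (cases "int p dvd y")
    case True
    have "chi (q (s * y)) = chi (q 0)" for s
      by (rule chi_cong [OF q_cong]) (use True in simp)
    then have "(\<Sum>s\<in>F. chi s * chi (q (s * y) * q y)) = (\<Sum>s\<in>F. chi s) * (chi (q 0) * chi (q y))"
      by (simp only: chi_mult sum_distrib_right)
    moreover have "chi y = 0" using True by (simp add: chi_eq_0_iff)
    ultimately show ?thesis by (simp add: chi_mult)
  next
    case False
    have "(\<Sum>x\<in>F. chi (y * q y) * chi (x * q x)) =
        (\<Sum>s\<in>F. chi (y * q y) * chi ((y * s + 0) * q (y * s + 0)))"
    proof (rule sum_F_affine [symmetric])
      fix x z assume "int p dvd x - z"
      then have "chi x = chi z" "chi (q x) = chi (q z)" using chi_cong q_cong by blast+
      then show "chi (y * q y) * chi (x * q x) = chi (y * q y) * chi (z * q z)" by (simp add: chi_mult)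
    qed (rule False)
    also have "\<dots> = (\<Sum>s\<in>F. chi (y\<^sup>2) * (chi s * chi (q (s * y) * q y)))"
      by (simp add: chi_mult power2_eq_square mult_ac)
    finally show ?thesis using False by (simp add: chi_square)
  qed
  have "(\<Sum>x\<in>F. chi (x * q x))\<^sup>2 = (\<Sum>y\<in>F. \<Sum>x\<in>F. chi (y * q y) * chi (x * q x))"
    by (simp only: power2_eq_square sum_product)
  also have "\<dots> = (\<Sum>y\<in>F. \<Sum>s\<in>F. chi s * (\<Sum>v\<in>F. of_bool (int p dvd q (s * y) - v * q y) * chi v))"
    by (simp only: row sum_chi_ratio)
  also have "\<dots> = (\<Sum>s\<in>F. \<Sum>y\<in>F. \<Sum>v\<in>F. chi s * chi v * of_bool (int p dvd q (s * y) - v * q y))"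
    by (subst sum.swap) (simp only: sum_distrib_left mult_ac)
  also have "\<dots> = (\<Sum>s\<in>F. \<Sum>v\<in>F. \<Sum>y\<in>F. chi s * chi v * of_bool (int p dvd q (s * y) - v * q y))"
    by (intro sum.cong [OF refl] sum.swap)
  also have "\<dots> = (\<Sum>s\<in>F. \<Sum>v\<in>F. chi s * chi v * N s v)"
    by (simp only: sum_distrib_left N_def)
  finally have sq: "(\<Sum>x\<in>F. chi (x * q x))\<^sup>2 = (\<Sum>s\<in>F. \<Sum>v\<in>F. chi s * chi v * N s v)" .
  have quad: "q (s * y) - v * q y = (s\<^sup>2 - v) * y\<^sup>2 + (2 * \<beta> * (s - v)) * y + \<gamma> * (1 - v)" for s v y
    by (simp add: q_def power2_eq_square algebra_simps)
  have N_bounds: "0 \<le> N s v" "N s v \<le> int p" for s v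
  proof -
    show "0 \<le> N s v" unfolding N_def by (intro sum_nonneg) simp
    have "N s v \<le> (\<Sum>y\<in>F. 1)" unfolding N_def by (intro sum_mono) simp
    then show "N s v \<le> int p" by simp
  qed
  have err: "\<bar>chi s * chi v * (N s v - (1 + chi (D s v)))\<bar>
      \<le> of_bool (int p dvd (- 1) * v + s\<^sup>2) * (2 + int p * of_bool (int p dvd s\<^sup>2 - 1))" for s v
  proof -
    have "\<bar>chi s * chi v * (N s v - (1 + chi (D s v)))\<bar> \<le> 1 * \<bar>N s v - (1 + chi (D s v))\<bar>"
      unfolding abs_mult by (intro mult_right_mono mult_le_one abs_chi_le) auto
    also have "\<dots> \<le> of_bool (int p dvd s\<^sup>2 - v) * (2 + int p * of_bool (int p dvd s\<^sup>2 - 1))"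
    proof (cases "int p dvd s\<^sup>2 - v")
      case False
      have disc: "(2 * \<beta> * (s - v))\<^sup>2 - 4 * (s\<^sup>2 - v) * (\<gamma> * (1 - v)) = 2\<^sup>2 * D s v"
        by (simp add: D_def power2_eq_square algebra_simps)
      have "N s v = 1 + chi (2\<^sup>2 * D s v)"
        unfolding N_def quad disc [symmetric] by (rule count_quadratic [OF False])
      also have "\<dots> = 1 + chi (D s v)" using not_dvd_2 by (simp only: chi_mult chi_square) simp
      finally show ?thesis using False by simp
    next
      case True
      have "\<bar>N s v - (1 + chi (D s v))\<bar> \<le> 2 + int p * of_bool (int p dvd s\<^sup>2 - 1)"
      \<comment> \<open>If \<open>s^2 = 1\<close> then \<open>v = 1\<close> and all coefficients but
        the linear one vanish, so only \<open>N s v <= p\<close> is used. Otherwise the constant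
        term \<open>\<gamma> (1 - v)\<close> is invertible and there is at most one root.\<close>
      proof (cases "int p dvd s\<^sup>2 - 1")
        case True
        then show ?thesis using N_bounds [of s v] chi_cases [of "D s v"] by auto
      next
        case False
        have v1: "\<not> int p dvd 1 - v"
        proof
          assume "int p dvd 1 - v"
          with True have "int p dvd (s\<^sup>2 - v) - (1 - v)" by (rule dvd_diff)
          then show False using False by simp
        qed
        have "int p dvd q (s * y) - v * q y \<longleftrightarrow> int p dvd (2 * \<beta> * (s - v)) * y + \<gamma> * (1 - v)" for y
          unfolding quad add.assoc by (rule dvd_add_right_iff) (use True in simp)
        then have N: "N s v = (\<Sum>y\<in>F. of_bool (int p dvd (2 * \<beta> * (s - v)) * y + \<gamma> * (1 - v)))"
          by (simp only: N_def)
        have "N s v = 0 \<or> N s v = 1"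
        proof (cases "int p dvd 2 * \<beta> * (s - v)")
          case True
          have "\<not> int p dvd (2 * \<beta> * (s - v)) * y + \<gamma> * (1 - v)" for y
          proof -
            have "int p dvd (2 * \<beta> * (s - v)) * y" using True by (rule dvd_mult2)
            then show ?thesis using \<gamma> v1 by (simp only: dvd_add_right_iff prime_dvd_mult) simp
          qed
          then show ?thesis by (simp add: N)
        next
          case False
          then show ?thesis unfolding N count_linear [OF False] by simp
        qed
        then show ?thesis using False chi_cases [of "D s v"] by auto
      qed
      then show ?thesis using True by simp
    qed
    finally show ?thesis by simp
  qed
  have "\<bar>(\<Sum>s\<in>F. \<Sum>v\<in>F. chi s * chi v * N s v) - (\<Sum>s\<in>F. \<Sum>v\<in>F. chi s * chi v * (1 + chi (D s v)))\<bar>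
      = \<bar>\<Sum>s\<in>F. \<Sum>v\<in>F. chi s * chi v * (N s v - (1 + chi (D s v)))\<bar>"
    by (simp only: right_diff_distrib sum_subtractf)
  also have "\<dots> \<le> (\<Sum>s\<in>F. \<Sum>v\<in>F. \<bar>chi s * chi v * (N s v - (1 + chi (D s v)))\<bar>)"
    by (rule order.trans [OF sum_abs sum_mono]) (rule sum_abs)
  also have "\<dots> \<le> (\<Sum>s\<in>F. \<Sum>v\<in>F. of_bool (int p dvd (- 1) * v + s\<^sup>2) * (2 + int p * of_bool (int p dvd s\<^sup>2 - 1)))"
    by (intro sum_mono err)
  also have "\<dots> = (\<Sum>s\<in>F. 2 + int p * of_bool (int p dvd s\<^sup>2 - 1))"
  proof (rule sum.cong [OF refl])
    fix s
    show "(\<Sum>v\<in>F. of_bool (int p dvd (- 1) * v + s\<^sup>2) * (2 + int p * of_bool (int p dvd s\<^sup>2 - 1))) =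
        2 + int p * of_bool (int p dvd s\<^sup>2 - 1)"
      by (rule sum_F_pick [where g = "\<lambda>_. 2 + int p * of_bool (int p dvd s\<^sup>2 - 1)" and t = "s\<^sup>2"])
        (use p_gt_2 in auto)
  qed
  also have "\<dots> = 2 * int p + int p * (\<Sum>s\<in>F. of_bool (int p dvd s\<^sup>2 - 1))"
    by (simp only: sum.distrib sum_distrib_left) simp
  \<comment> \<open>The congruence \<open>s^2 = 1\<close> has \<open>1 + chi 1 = 2\<close>
    solutions, each costing \<open>p\<close>.\<close>
  also have "\<dots> = 4 * int p" by (simp only: count_square chi_1) simp
  finally show ?thesis unfolding sq [symmetric] by (simp only: q_def D_def)
qed

text \<open>Up to sign and normalisation this is the finite-field hypergeometric function 3F2 at
  \<open>l\<close>, with quadratic upper and trivial lower characters; replacing \<open>u\<close> by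
  \<open>1/u\<close> yields the usual factor \<open>1 - l u v\<close>.\<close>

definition clausen_sum :: "int \<Rightarrow> int" where
  "clausen_sum l = (\<Sum>v\<in>F. \<Sum>u\<in>F. chi (v * (v - 1)) * chi (u * (u - 1)) * chi (u - l * v))"

text \<open>With \<open>v = s w\<close>, \<open>t = w + 1/w\<close> and \<open>r = s + 1/s\<close>,
  one has \<open>D s v = s^2 w ((\<beta>^2 - \<gamma>) t + \<gamma> r - 2 \<beta>^2)\<close>. By the
  choice of \<open>\<beta>\<close> the bracket is \<open>\<gamma> (r - l t - 2 (1 - l))\<close>
  modulo \<open>p\<close>, so two reciprocal substitutions apply.\<close>

lemma double_sum_eq_clausen_sum:
  assumes l: "\<not> int p dvd l" and \<beta>: "int p dvd \<beta>\<^sup>2 - \<gamma> * (1 - l)"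
  shows "(\<Sum>s\<in>F. \<Sum>v\<in>F. chi s * chi v * (1 + chi (\<beta>\<^sup>2 * (s - v)\<^sup>2 - \<gamma> * (s\<^sup>2 - v) * (1 - v))))
    = chi (- \<gamma>) * clausen_sum l"
proof -
  define D where "D s v = \<beta>\<^sup>2 * (s - v)\<^sup>2 - \<gamma> * (s\<^sup>2 - v) * (1 - v)" for s v
  define G where "G s w = (\<beta>\<^sup>2 - \<gamma>) * s * (w\<^sup>2 + 1) + (\<gamma> * (s\<^sup>2 + 1) - 2 * \<beta>\<^sup>2 * s) * w" for s w
  have row: "(\<Sum>v\<in>F. chi s * chi v * (1 + chi (D s v))) = (\<Sum>w\<in>F. chi (s * w * G s w))" for s
  proof -
    have "(\<Sum>v\<in>F. chi s * chi v * (1 + chi (D s v))) =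
        chi s * (\<Sum>v\<in>F. chi v) + (\<Sum>v\<in>F. chi (s * v * D s v))"
      by (simp only: distrib_left sum.distrib sum_distrib_left chi_mult) simp
    also have "\<dots> = (\<Sum>v\<in>F. chi (s * v * D s v))" by simp
    also have "\<dots> = (\<Sum>w\<in>F. chi (s * w * G s w))"
    proof (cases "int p dvd s")
      case True
      then have "chi s = 0" by (simp add: chi_eq_0_iff)
      then show ?thesis by (simp add: chi_mult)
    next
      case False
      have "(\<Sum>v\<in>F. chi (s * v * D s v)) = (\<Sum>w\<in>F. chi (s * (s * w + 0) * D s (s * w + 0)))"
      proof (rule sum_F_affine [symmetric])
        fix x y assume xy: "int p dvd x - y"
        have "D s x - D s y = (x - y) * (\<beta>\<^sup>2 * (x + y - 2 * s) - \<gamma> * (x + y - s\<^sup>2 - 1))"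
          by (simp add: D_def power2_eq_square algebra_simps)
        then have "chi (D s x) = chi (D s y)" using xy by (intro chi_cong) simp
        then show "chi (s * x * D s x) = chi (s * y * D s y)"
          using chi_cong [OF xy] by (simp add: chi_mult)
      qed (rule False)
      also have "\<dots> = (\<Sum>w\<in>F. chi (s\<^sup>2 * (s * w * G s w)))"
      proof (rule sum.cong [OF refl])
        fix w
        have "s * (s * w + 0) * D s (s * w + 0) = s\<^sup>2 * (s * w * G s w)"
          by (simp add: D_def G_def power2_eq_square algebra_simps)
        then show "chi (s * (s * w + 0) * D s (s * w + 0)) = chi (s\<^sup>2 * (s * w * G s w))" by (simp only:)
      qed
      also have "\<dots> = (\<Sum>w\<in>F. chi (s * w * G s w))"
        using False by (simp only: chi_mult chi_square) simp
      finally show ?thesis .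
    qed
    finally show ?thesis .
  qed
  define H where "H t r = (1 + chi (t\<^sup>2 - 4)) * ((1 + chi (r\<^sup>2 - 4)) * (chi \<gamma> * chi (r - l * t - 2 * (1 - l))))" for t r
  have "(\<Sum>s\<in>F. \<Sum>w\<in>F. chi (s * w * G s w)) =
      (\<Sum>s\<in>F. \<Sum>t\<in>F. (1 + chi (t\<^sup>2 - 4)) *
        chi (s * ((\<beta>\<^sup>2 - \<gamma>) * s * t + (\<gamma> * (s\<^sup>2 + 1) - 2 * \<beta>\<^sup>2 * s))))"
    unfolding G_def by (simp only: sum_chi_reciprocal)
  also have "\<dots> = (\<Sum>t\<in>F. (1 + chi (t\<^sup>2 - 4)) *
      (\<Sum>s\<in>F. chi (s * ((\<beta>\<^sup>2 - \<gamma>) * s * t + (\<gamma> * (s\<^sup>2 + 1) - 2 * \<beta>\<^sup>2 * s)))))"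
    by (subst sum.swap) (simp only: sum_distrib_left)
  also have "\<dots> = (\<Sum>t\<in>F. \<Sum>r\<in>F. H t r)"
  proof (rule sum.cong [OF refl])
    fix t
    have "s * ((\<beta>\<^sup>2 - \<gamma>) * s * t + (\<gamma> * (s\<^sup>2 + 1) - 2 * \<beta>\<^sup>2 * s)) =
        1 * s * (\<gamma> * (s\<^sup>2 + 1) + ((\<beta>\<^sup>2 - \<gamma>) * t - 2 * \<beta>\<^sup>2) * s)" for s
      by (simp add: algebra_simps)
    then have "(\<Sum>s\<in>F. chi (s * ((\<beta>\<^sup>2 - \<gamma>) * s * t + (\<gamma> * (s\<^sup>2 + 1) - 2 * \<beta>\<^sup>2 * s)))) =
        (\<Sum>s\<in>F. chi (1 * s * (\<gamma> * (s\<^sup>2 + 1) + ((\<beta>\<^sup>2 - \<gamma>) * t - 2 * \<beta>\<^sup>2) * s)))"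
      by (simp only:)
    also have "\<dots> = (\<Sum>r\<in>F. (1 + chi (r\<^sup>2 - 4)) * chi (1 * (\<gamma> * r + ((\<beta>\<^sup>2 - \<gamma>) * t - 2 * \<beta>\<^sup>2))))"
      by (rule sum_chi_reciprocal)
    also have "\<dots> = (\<Sum>r\<in>F. (1 + chi (r\<^sup>2 - 4)) * (chi \<gamma> * chi (r - l * t - 2 * (1 - l))))"
    proof (rule sum.cong [OF refl])
      fix r
      have "1 * (\<gamma> * r + ((\<beta>\<^sup>2 - \<gamma>) * t - 2 * \<beta>\<^sup>2)) - \<gamma> * (r - l * t - 2 * (1 - l)) =
          (\<beta>\<^sup>2 - \<gamma> * (1 - l)) * (t - 2)"
        by (simp add: algebra_simps)
      then have "chi (1 * (\<gamma> * r + ((\<beta>\<^sup>2 - \<gamma>) * t - 2 * \<beta>\<^sup>2))) = chi (\<gamma> * (r - l * t - 2 * (1 - l)))"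
        using \<beta> by (intro chi_cong) simp
      then show "(1 + chi (r\<^sup>2 - 4)) * chi (1 * (\<gamma> * r + ((\<beta>\<^sup>2 - \<gamma>) * t - 2 * \<beta>\<^sup>2))) =
          (1 + chi (r\<^sup>2 - 4)) * (chi \<gamma> * chi (r - l * t - 2 * (1 - l)))"
        by (simp add: chi_mult)
    qed
    finally show "(1 + chi (t\<^sup>2 - 4)) *
        (\<Sum>s\<in>F. chi (s * ((\<beta>\<^sup>2 - \<gamma>) * s * t + (\<gamma> * (s\<^sup>2 + 1) - 2 * \<beta>\<^sup>2 * s)))) = (\<Sum>r\<in>F. H t r)"
      by (simp add: H_def sum_distrib_left)
  qed
  \<comment> \<open>The substitution \<open>t = 2 - 4 v\<close>, \<open>r = 2 - 4 u\<close> turns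
    \<open>t^2 - 4\<close> into \<open>16 v (v - 1)\<close> and the linear form into
    \<open>-4 (u - l v)\<close>.\<close>
  also have "\<dots> = (\<Sum>v\<in>F. \<Sum>u\<in>F. H ((- 4) * v + 2) ((- 4) * u + 2))"
  proof -
    have sq: "int p dvd (x\<^sup>2 - 4) - (y\<^sup>2 - 4)" if "int p dvd x - y" for x y :: int
    proof -
      have "(x\<^sup>2 - 4) - (y\<^sup>2 - 4) = (x - y) * (x + y)" by (simp add: power2_eq_square algebra_simps)
      then show ?thesis using that by simp
    qed
    have H2: "H t x = H t y" if xy: "int p dvd x - y" for t x y
    proof -
      have "chi (x - l * t - 2 * (1 - l)) = chi (y - l * t - 2 * (1 - l))"
        using xy by (intro chi_cong) simp
      then show ?thesis using chi_cong [OF sq [OF xy]] by (simp add: H_def)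
    qed
    have H1: "H x r = H y r" if xy: "int p dvd x - y" for x y r
    proof -
      have "(r - l * x - 2 * (1 - l)) - (r - l * y - 2 * (1 - l)) = (x - y) * (- l)"
        by (simp add: algebra_simps)
      then have "chi (r - l * x - 2 * (1 - l)) = chi (r - l * y - 2 * (1 - l))"
        using xy by (intro chi_cong) simp
      then show ?thesis using chi_cong [OF sq [OF xy]] by (simp add: H_def)
    qed
    have 4: "\<not> int p dvd - 4" using not_dvd_2 prime_dvd_mult [of 2 2] by simp
    have "(\<Sum>t\<in>F. \<Sum>r\<in>F. H t r) = (\<Sum>v\<in>F. \<Sum>r\<in>F. H ((- 4) * v + 2) r)"
      by (rule sum_F_affine [symmetric, OF 4]) (intro sum.cong [OF refl] H1)
    also have "\<dots> = (\<Sum>v\<in>F. \<Sum>u\<in>F. H ((- 4) * v + 2) ((- 4) * u + 2))"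
      by (intro sum.cong [OF refl] sum_F_affine [symmetric, OF 4] H2)
    finally show ?thesis .
  qed
  also have "\<dots> = (\<Sum>v\<in>F. \<Sum>u\<in>F. chi (- \<gamma>) * ((1 + chi (v * (v - 1))) * (1 + chi (u * (u - 1))) * chi (u - l * v)))"
  proof (intro sum.cong [OF refl])
    fix u v
    have "((- 4) * x + 2)\<^sup>2 - 4 = 2\<^sup>2 * (2\<^sup>2 * (x * (x - 1)))" for x :: int
      by (simp add: power2_eq_square algebra_simps)
    then have 1: "chi (((- 4) * x + 2)\<^sup>2 - 4) = chi (x * (x - 1))" for x
      using not_dvd_2 by (simp only: chi_mult chi_square) simp
    have "((- 4) * u + 2) - l * ((- 4) * v + 2) - 2 * (1 - l) = 2\<^sup>2 * ((- 1) * (u - l * v))"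
      by (simp add: algebra_simps)
    then have 2: "chi (((- 4) * u + 2) - l * ((- 4) * v + 2) - 2 * (1 - l)) = chi (- 1) * chi (u - l * v)"
      using not_dvd_2 by (simp only: chi_mult chi_square) simp
    have "chi (- \<gamma>) = chi (- 1) * chi \<gamma>" using chi_mult [of "- 1" \<gamma>] by simp
    then show "H ((- 4) * v + 2) ((- 4) * u + 2) =
        chi (- \<gamma>) * ((1 + chi (v * (v - 1))) * (1 + chi (u * (u - 1))) * chi (u - l * v))"
      unfolding H_def 1 2 by (simp add: mult_ac)
  qed
  also have "\<dots> = chi (- \<gamma>) * clausen_sum l"
  proof -
    \<comment> \<open>On expansion, each term other than the Clausen sum has a free variable
      occurring only in \<open>chi (u - l * v)\<close>, so it vanishes.\<close>
    have u0: "(\<Sum>u\<in>F. chi (u - l * v)) = 0" for v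
      using sum_chi_linear [of 1 "- (l * v)"] p_gt_2 by simp
    have v0: "(\<Sum>v\<in>F. chi (u - l * v)) = 0" for u
      using sum_chi_linear [of "- l" u] l by (simp add: algebra_simps)
    have "(\<Sum>v\<in>F. \<Sum>u\<in>F. (1 + chi (v * (v - 1))) * (1 + chi (u * (u - 1))) * chi (u - l * v)) =
        (\<Sum>v\<in>F. (1 + chi (v * (v - 1))) * (\<Sum>u\<in>F. chi (u - l * v)))
        + (\<Sum>v\<in>F. \<Sum>u\<in>F. chi (u * (u - 1)) * chi (u - l * v)) + clausen_sum l"
      unfolding clausen_sum_def sum_distrib_left sum.distrib [symmetric]
      by (intro sum.cong [OF refl]) (simp add: algebra_simps)
    also have "(\<Sum>v\<in>F. \<Sum>u\<in>F. chi (u * (u - 1)) * chi (u - l * v)) =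
        (\<Sum>u\<in>F. chi (u * (u - 1)) * (\<Sum>v\<in>F. chi (u - l * v)))"
      by (subst sum.swap) (simp only: sum_distrib_left)
    finally show ?thesis by (simp add: u0 v0 sum_distrib_left [symmetric])
  qed
  finally show ?thesis unfolding row [symmetric] by (simp only: D_def)
qed

lemma abs_clausen_sum_le:
  assumes l: "\<not> int p dvd l"
  shows "\<bar>clausen_sum l\<bar> \<le> 1604 * int p"
proof -
  have "\<exists>\<beta> \<gamma>. \<not> int p dvd \<gamma> \<and> int p dvd \<beta>\<^sup>2 - \<gamma> * (1 - l)"
  \<comment> \<open>The choice is \<open>\<beta> = \<gamma> = 1 - l\<close>, or
    \<open>\<beta> = 0\<close> and \<open>\<gamma> = 1\<close> when \<open>l = 1\<close> modulo
    \<open>p\<close>.\<close>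
  proof (cases "int p dvd 1 - l")
    case True
    then show ?thesis using p_gt_2 by (intro exI [of _ 0] exI [of _ 1]) (simp add: dvd_diff_commute)
  next
    case False
    then show ?thesis by (intro exI [of _ "1 - l"]) (simp add: power2_eq_square)
  qed
  then obtain \<beta> \<gamma> where \<gamma>: "\<not> int p dvd \<gamma>" and \<beta>: "int p dvd \<beta>\<^sup>2 - \<gamma> * (1 - l)" by blast
  let ?A = "\<Sum>x\<in>F. chi (x * (x\<^sup>2 + 2 * \<beta> * x + \<gamma>))"
  have "\<bar>?A\<^sup>2 - chi (- \<gamma>) * clausen_sum l\<bar> \<le> 4 * int p"
    using square_of_cubic_sum [OF \<gamma>, of \<beta>] double_sum_eq_clausen_sum [OF l \<beta>] by simp
  moreover have "?A\<^sup>2 \<le> 1600 * int p" by (rule weil_bound_even_torsion [OF \<gamma>])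
  moreover have "0 \<le> ?A\<^sup>2" by simp
  ultimately have "\<bar>chi (- \<gamma>) * clausen_sum l\<bar> \<le> 1604 * int p" by linarith
  moreover have "chi (- \<gamma>) = 1 \<or> chi (- \<gamma>) = - 1"
    using \<gamma> chi_cases [of "- \<gamma>"] chi_eq_0_iff [of "- \<gamma>"] by auto
  ultimately show ?thesis by auto
qed

section \<open>From the Clausen sum back to the original sum\<close>

lemma abs_sum_chi_le:
  fixes X :: "int \<Rightarrow> int" and g :: "int \<Rightarrow> int"
  assumes c: "\<not> int p dvd c" and g: "\<And>x. \<bar>g x\<bar> \<le> k"
    and X: "\<And>x. \<not> int p dvd c * x + e \<Longrightarrow> \<bar>X x\<bar> \<le> 1" "\<And>x. \<bar>X x\<bar> \<le> int p"
  shows "\<bar>\<Sum>x\<in>F. g x * X x\<bar> \<le> 2 * k * int p"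
proof -
  have k: "0 \<le> k" using g [of 0] by linarith
  \<comment> \<open>At most one residue class, the root of \<open>c x + e\<close>, needs the trivial
    bound \<open>p\<close>; the others contribute at most \<open>k p\<close> together.\<close>
  have "\<bar>\<Sum>x\<in>F. g x * X x\<bar> \<le> (\<Sum>x\<in>F. k * (1 + int p * of_bool (int p dvd c * x + e)))"
  proof (rule order.trans [OF sum_abs sum_mono])
    fix x
    have "\<bar>X x\<bar> \<le> 1 + int p * of_bool (int p dvd c * x + e)"
      using X(1) [of x] X(2) [of x] by (cases "int p dvd c * x + e") auto
    then show "\<bar>g x * X x\<bar> \<le> k * (1 + int p * of_bool (int p dvd c * x + e))"
      unfolding abs_mult using g k by (intro mult_mono) auto
  qed
  also have "\<dots> = k * (int p + int p * (\<Sum>x\<in>F. of_bool (int p dvd c * x + e)))"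
    unfolding sum_distrib_left [symmetric] sum.distrib by simp
  also have "\<dots> = 2 * k * int p" by (simp only: count_linear [OF c]) simp
  finally show ?thesis .
qed

lemma abs_sum_chi_product_le:
  "\<bar>\<Sum>x\<in>F. chi (f x) * chi (g x)\<bar> \<le> int p"
proof -
  have "\<bar>\<Sum>x\<in>F. chi (f x) * chi (g x)\<bar> \<le> (\<Sum>x\<in>F. 1)"
    by (rule order.trans [OF sum_abs sum_mono]) (simp add: chi_mult [symmetric] abs_chi_le)
  then show ?thesis by simp
qed

lemma complete_sum_bound:
  assumes l: "\<not> int p dvd l"
  shows "\<bar>\<Sum>b\<in>F. \<Sum>c\<in>F. chi (b\<^sup>2 - l * c\<^sup>2) * chi (b\<^sup>2 - 1) * chi (c\<^sup>2 - 1)\<bar> \<le> 1610 * int p"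
proof -
  define E where "E u v = chi (u - l * v) * chi (u - 1) * chi (v - 1)" for u v
  have E1: "E x v = E y v" if "int p dvd x - y" for x y v
    using that by (auto simp: E_def intro!: arg_cong2 [where f = "(*)"] chi_cong)
  have E2: "E u x = E u y" if xy: "int p dvd x - y" for x y u
  proof -
    have "(u - l * x) - (u - l * y) = (x - y) * (- l)" by (simp add: algebra_simps)
    then have "chi (u - l * x) = chi (u - l * y)" using xy by (intro chi_cong) simp
    moreover have "chi (x - 1) = chi (y - 1)" using xy by (intro chi_cong) simp
    ultimately show ?thesis by (simp add: E_def)
  qed
  have "(\<Sum>b\<in>F. \<Sum>c\<in>F. E (b\<^sup>2) (c\<^sup>2)) = (\<Sum>b\<in>F. \<Sum>v\<in>F. (1 + chi v) * E (b\<^sup>2) v)"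
    by (intro sum.cong [OF refl] sum_over_squares E2)
  also have "\<dots> = (\<Sum>u\<in>F. (1 + chi u) * (\<Sum>v\<in>F. (1 + chi v) * E u v))"
  proof (rule sum_over_squares)
    fix x y :: int
    assume "int p dvd x - y"
    then show "(\<Sum>v\<in>F. (1 + chi v) * E x v) = (\<Sum>v\<in>F. (1 + chi v) * E y v)"
      by (simp only: E1)
  qed
  \<comment> \<open>The first term is free of \<open>chi v\<close> and the second of
    \<open>chi u\<close>, so each has an inner sum over two linear factors.\<close>
  also have "\<dots> = (\<Sum>u\<in>F. \<Sum>v\<in>F. (1 + chi u) * E u v) + (\<Sum>u\<in>F. \<Sum>v\<in>F. chi v * E u v)
      + (\<Sum>u\<in>F. \<Sum>v\<in>F. chi u * chi v * E u v)"
    unfolding sum_distrib_left sum.distrib [symmetric]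
    by (intro sum.cong [OF refl]) (simp add: algebra_simps)
  also have "(\<Sum>u\<in>F. \<Sum>v\<in>F. chi u * chi v * E u v) = clausen_sum l"
    unfolding clausen_sum_def E_def by (subst sum.swap) (simp add: chi_mult mult_ac)
  also have "(\<Sum>u\<in>F. \<Sum>v\<in>F. (1 + chi u) * E u v) =
      (\<Sum>u\<in>F. ((1 + chi u) * chi (u - 1)) * (\<Sum>v\<in>F. chi (u - l * v) * chi (v - 1)))"
    unfolding sum_distrib_left E_def by (intro sum.cong [OF refl]) (simp add: mult_ac)
  also have "(\<Sum>u\<in>F. \<Sum>v\<in>F. chi v * E u v) =
      (\<Sum>v\<in>F. (chi v * chi (v - 1)) * (\<Sum>u\<in>F. chi (u - l * v) * chi (u - 1)))"
    unfolding sum_distrib_left E_def by (subst sum.swap, intro sum.cong [OF refl]) (simp add: mult_ac)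
  finally have eq: "(\<Sum>b\<in>F. \<Sum>c\<in>F. E (b\<^sup>2) (c\<^sup>2)) =
      (\<Sum>u\<in>F. ((1 + chi u) * chi (u - 1)) * (\<Sum>v\<in>F. chi (u - l * v) * chi (v - 1)))
      + (\<Sum>v\<in>F. (chi v * chi (v - 1)) * (\<Sum>u\<in>F. chi (u - l * v) * chi (u - 1))) + clausen_sum l" .
  have "\<bar>\<Sum>u\<in>F. ((1 + chi u) * chi (u - 1)) * (\<Sum>v\<in>F. chi (u - l * v) * chi (v - 1))\<bar> \<le> 2 * 2 * int p"
  proof (rule abs_sum_chi_le [where c = 1 and e = "- l"])
    show "\<bar>(1 + chi u) * chi (u - 1)\<bar> \<le> 2" for u
      using chi_cases [of u] chi_cases [of "u - 1"] by auto
    show "\<bar>\<Sum>v\<in>F. chi (u - l * v) * chi (v - 1)\<bar> \<le> 1" if "\<not> int p dvd 1 * u + - l" for u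
    proof -
      \<comment> \<open>The two linear factors in \<open>v\<close> are proportional only for
        \<open>u = l\<close>.\<close>
      have "\<not> int p dvd (- l) * (- 1) - u * 1" using that by (simp add: dvd_diff_commute)
      from sum_chi_two_linear [OF this] show ?thesis
        using abs_chi_le [of "- l"] by (simp add: chi_mult)
    qed
  qed (use p_gt_2 abs_sum_chi_product_le in auto)
  moreover have "\<bar>\<Sum>v\<in>F. (chi v * chi (v - 1)) * (\<Sum>u\<in>F. chi (u - l * v) * chi (u - 1))\<bar> \<le> 2 * 1 * int p"
  proof (rule abs_sum_chi_le [where c = l and e = "- 1"])
    show "\<bar>chi v * chi (v - 1)\<bar> \<le> 1" for v
      using chi_cases [of v] chi_cases [of "v - 1"] by auto
    show "\<bar>\<Sum>u\<in>F. chi (u - l * v) * chi (u - 1)\<bar> \<le> 1" if "\<not> int p dvd l * v + - 1" for v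
    proof -
      have "\<not> int p dvd 1 * (- 1) - (- (l * v)) * 1" using that by simp
      from sum_chi_two_linear [OF this] show ?thesis by (simp add: chi_mult)
    qed
  qed (use l abs_sum_chi_product_le in auto)
  \<comment> \<open>The constant is \<open>4 + 2 + 1604\<close>.\<close>
  ultimately have "\<bar>\<Sum>b\<in>F. \<Sum>c\<in>F. E (b\<^sup>2) (c\<^sup>2)\<bar> \<le> 1610 * int p"
    unfolding eq using abs_clausen_sum_le [OF l] by linarith
  then show ?thesis by (simp only: E_def)
qed

text \<open>Removing the lines \<open>b = 0\<close> and \<open>c = 0\<close> costs at most
  \<open>p\<close> each.\<close>

lemma punctured_sum_bound:
  assumes l: "\<not> int p dvd l"
  shows "\<bar>\<Sum>b\<in>{1..int p - 1}. \<Sum>c\<in>{1..int p - 1}.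
    chi (b\<^sup>2 - l * c\<^sup>2) * chi (b\<^sup>2 - 1) * chi (c\<^sup>2 - 1)\<bar> \<le> 1612 * int p"
proof -
  let ?E = "\<lambda>b c. chi (b\<^sup>2 - l * c\<^sup>2) * chi (b\<^sup>2 - 1) * chi (c\<^sup>2 - 1)"
  let ?U = "{1..int p - 1}"
  have F: "F = insert 0 ?U" using p_gt_2 by (auto simp: F_def)
  have E: "\<bar>?E b c\<bar> \<le> 1" for b c
    by (simp only: chi_mult [symmetric] abs_chi_le)
  have "(\<Sum>b\<in>F. \<Sum>c\<in>F. ?E b c) = (\<Sum>c\<in>F. ?E 0 c) + (\<Sum>b\<in>?U. \<Sum>c\<in>F. ?E b c)"
    by (subst (1) F) simp
  also have "(\<Sum>b\<in>?U. \<Sum>c\<in>F. ?E b c) = (\<Sum>b\<in>?U. ?E b 0) + (\<Sum>b\<in>?U. \<Sum>c\<in>?U. ?E b c)"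
    unfolding F by (simp add: sum.distrib)
  finally have "(\<Sum>b\<in>?U. \<Sum>c\<in>?U. ?E b c) =
      (\<Sum>b\<in>F. \<Sum>c\<in>F. ?E b c) - (\<Sum>c\<in>F. ?E 0 c) - (\<Sum>b\<in>?U. ?E b 0)"
    by linarith
  moreover have "\<bar>\<Sum>c\<in>F. ?E 0 c\<bar> \<le> (\<Sum>c\<in>F. 1)"
    by (rule order.trans [OF sum_abs sum_mono]) (rule E)
  moreover have "\<bar>\<Sum>b\<in>?U. ?E b 0\<bar> \<le> (\<Sum>b\<in>?U. 1)"
    by (rule order.trans [OF sum_abs sum_mono]) (rule E)
  ultimately show ?thesis using complete_sum_bound [OF l] p_gt_2 by simp
qed

end

theorem theorem3:
  shows "\<exists>K::real. K > 0 \<and>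
    (\<forall>(p::int) (a::int). prime p \<longrightarrow> odd p \<longrightarrow> \<not> p dvd a \<longrightarrow>
      \<bar>real_of_int (\<Sum>b\<in>{1..p-1}. \<Sum>c\<in>{1..p-1}.
          Legendre (b^2 - a^2 * c^2) p * Legendre (b^2 - 1) p * Legendre (c^2 - 1) p)\<bar>
        \<le> K * real_of_int p)"
proof (intro exI [of _ 1612] conjI allI impI)
  fix p a :: int
  assume p: "prime p" "odd p" "\<not> p dvd a"
  define q where "q = nat p"
  have pq: "p = int q" using prime_gt_0_int [OF p(1)] by (simp add: q_def)
  have "q \<noteq> 2" using p pq by auto
  then have "2 < q" using p pq prime_ge_2_nat [of q] by simp
  then interpret odd_prime q using p pq by unfold_locales simp
  have "\<not> int q dvd a\<^sup>2" using p pq prime_dvd_mult [of a a] by (simp add: power2_eq_square)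
  from punctured_sum_bound [OF this]
  have "\<bar>\<Sum>b\<in>{1..p-1}. \<Sum>c\<in>{1..p-1}.
      Legendre (b^2 - a^2 * c^2) p * Legendre (b^2 - 1) p * Legendre (c^2 - 1) p\<bar> \<le> 1612 * p"
    (is "\<bar>?S\<bar> \<le> _")
    by (simp only: chi_def pq)
  then have "real_of_int \<bar>?S\<bar> \<le> real_of_int (1612 * p)" by (simp only: of_int_le_iff)
  then show "\<bar>real_of_int (\<Sum>b\<in>{1..p-1}. \<Sum>c\<in>{1..p-1}.
      Legendre (b^2 - a^2 * c^2) p * Legendre (b^2 - 1) p * Legendre (c^2 - 1) p)\<bar> \<le> 1612 * real_of_int p"
    by (simp only: of_int_abs of_int_mult of_int_numeral)
qed simp

end
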